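(* Let $\alpha\in\mathbb{T}\setminus\mathbb{Q}$, $\omega\in\mathbb{T}$, $\lambda\in\mathbb{C}$, and let $g\in\mathbb{C}$ with $\Re g\ge0$. Consider the operator on $\ell^2(\mathbb{Z})$ $$(H_\alpha(\lambda,\omega)u)(n)=e^{-g}u(n-1)+e^{g}u(n+1)+\lambda e^{2\pi i(\omega+n\alpha)}u(n),\quad n\in\mathbb{Z}.$$ Then, for all $\omega\in\mathbb{T}$, $$\sigma(H_\alpha(\lambda,\omega))=\begin{cases}\{e^{-g}e^{2\pi i\theta}+e^{g}e^{-2\pi i\theta}\ :\ \theta\in[0,1]\}, & |\lambda|<e^{\Re g},\\[2pt] \{\eta e^{-g}e^{2\pi i\theta}+\frac1\eta e^{g}e^{-2\pi i\theta}\ :\ \eta\in[1,e^{\Re g}],\ \theta\in[0,1]\}, & |\lambda|=e^{\Re g},\\[2pt] \{\frac{e^{\Re g}}{|\lambda|}e^{-g}e^{2\pi i\theta}+e^{-\Re g}|\lambda|e^{g}e^{-2\pi i\theta}\ :\ \theta\in[0,1]\}, & |\lambda|>e^{\Re g}.\end{cases}$$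
   Context: $\mathbb{T}=\mathbb{R}/\mathbb{Z}$; $\sigma(\cdot)$ denotes the spectrum of a bounded operator. *)

theory Defs
  imports "HOL-Analysis.Analysis"
begin

definition l2 :: "(int \<Rightarrow> complex) set" where
  "l2 = {u. (\<lambda>n. (cmod (u n))\<^sup>2) summable_on UNIV}"

definition l2_norm :: "(int \<Rightarrow> complex) \<Rightarrow> real" where
  "l2_norm u = sqrt (\<Sum>\<^sub>\<infinity>n. (cmod (u n))\<^sup>2)"

text \<open>Operators on the sequence space are functions on all sequences; only their restriction to
  \<open>l2\<close> matters.\<close>

definition bounded_op :: "((int \<Rightarrow> complex) \<Rightarrow> (int \<Rightarrow> complex)) \<Rightarrow> bool" where
  "bounded_op T \<longleftrightarrow>
     (\<forall>u\<in>l2. T u \<in> l2) \<and>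
     (\<forall>u\<in>l2. \<forall>v\<in>l2. T (\<lambda>n. u n + v n) = (\<lambda>n. T u n + T v n)) \<and>
     (\<forall>c. \<forall>u\<in>l2. T (\<lambda>n. c * u n) = (\<lambda>n. c * T u n)) \<and>
     (\<exists>C. \<forall>u\<in>l2. l2_norm (T u) \<le> C * l2_norm u)"

definition spectrum :: "((int \<Rightarrow> complex) \<Rightarrow> (int \<Rightarrow> complex)) \<Rightarrow> complex set" where
  "spectrum T = {z. \<not> (\<exists>R. bounded_op R \<and>
     (\<forall>u\<in>l2. R (\<lambda>n. T u n - z * u n) = u \<and> (\<lambda>n. T (R u) n - z * R u n) = u))}"

text \<open>Elements of \<open>\<real>/\<int>\<close> are given by real representatives: \<open>cis (2 * pi * x)\<close>, that is
  \<open>exp (2 * pi * \<i> * x)\<close>, depends on \<open>x\<close> only modulo 1, so \<open>H\<close> depends only on the classes of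
  \<open>\<alpha>\<close> and \<open>\<omega>\<close>, and a class is irrational iff one (equivalently, each) representative is.\<close>

definition H :: "complex \<Rightarrow> real \<Rightarrow> complex \<Rightarrow> real \<Rightarrow> (int \<Rightarrow> complex) \<Rightarrow> (int \<Rightarrow> complex)" where
  "H g \<alpha> lam \<omega> u = (\<lambda>n. exp (- g) * u (n - 1) + exp g * u (n + 1)
       + lam * cis (2 * pi * (\<omega> + of_int n * \<alpha>)) * u n)"

lemma l2_shift:
  assumes "u \<in> l2"
  shows "(\<lambda>n. (cmod (u (n + k)))\<^sup>2) summable_on UNIV"
    and "(\<Sum>\<^sub>\<infinity>n. (cmod (u (n + k)))\<^sup>2) = (\<Sum>\<^sub>\<infinity>n. (cmod (u n))\<^sup>2)"
proof -
  have b: "bij_betw (\<lambda>n::int. n + k) UNIV UNIV"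
    by (rule bij_betw_byWitness[where f' = "\<lambda>n. n - k"]) auto
  show "(\<lambda>n. (cmod (u (n + k)))\<^sup>2) summable_on UNIV"
    using summable_on_reindex_bij_betw[OF b, of "\<lambda>n. (cmod (u n))\<^sup>2"] assms by (simp add: l2_def)
  show "(\<Sum>\<^sub>\<infinity>n. (cmod (u (n + k)))\<^sup>2) = (\<Sum>\<^sub>\<infinity>n. (cmod (u n))\<^sup>2)"
    using infsum_reindex_bij_betw[OF b, of "\<lambda>n. (cmod (u n))\<^sup>2"] by simp
qed

lemma norm_add3_square_le:
  fixes a b c :: complex
  shows "(cmod (a + b + c))\<^sup>2 \<le> 3 * ((cmod a)\<^sup>2 + (cmod b)\<^sup>2 + (cmod c)\<^sup>2)"
proof -
  have "cmod (a + b + c) \<le> cmod a + cmod b + cmod c"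
    by (meson add_mono norm_triangle_ineq norm_triangle_mono order_refl)
  then have "(cmod (a + b + c))\<^sup>2 \<le> (cmod a + cmod b + cmod c)\<^sup>2"
    by (rule power_mono) simp
  also have "\<dots> \<le> 3 * ((cmod a)\<^sup>2 + (cmod b)\<^sup>2 + (cmod c)\<^sup>2)"
  proof -
    have "0 \<le> (cmod a - cmod b)\<^sup>2 + (cmod b - cmod c)\<^sup>2 + (cmod a - cmod c)\<^sup>2" by simp
    then show ?thesis by (simp add: power2_eq_square algebra_simps)
  qed
  finally show ?thesis .
qed

lemma bounded_op_H: "bounded_op (H g \<alpha> lam \<omega>)"
proof -
  define a b c where "a = 3 * (cmod (exp (- g)))\<^sup>2" and "b = 3 * (cmod (exp g))\<^sup>2"
    and "c = 3 * (cmod lam)\<^sup>2"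
  have nn: "0 \<le> a + b + c" by (simp add: a_def b_def c_def)
  have key: "H g \<alpha> lam \<omega> u \<in> l2 \<and>
      l2_norm (H g \<alpha> lam \<omega> u) \<le> sqrt (a + b + c) * l2_norm u" if u: "u \<in> l2" for u
  proof -
    let ?N = "\<Sum>\<^sub>\<infinity>n. (cmod (u n))\<^sup>2"
    let ?f = "\<lambda>n. a * (cmod (u (n + - 1)))\<^sup>2 + b * (cmod (u (n + 1)))\<^sup>2 + c * (cmod (u (n + 0)))\<^sup>2"
    note s = l2_shift(1)[OF u]
    have le: "(cmod (H g \<alpha> lam \<omega> u n))\<^sup>2 \<le> ?f n" for n
      unfolding H_def
      by (rule order_trans[OF norm_add3_square_le])
         (simp add: norm_mult power_mult_distrib a_def b_def c_def algebra_simps)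
    have sa: "(\<lambda>n. a * (cmod (u (n + - 1)))\<^sup>2) summable_on UNIV"
      and sb: "(\<lambda>n. b * (cmod (u (n + 1)))\<^sup>2) summable_on UNIV"
      and sc: "(\<lambda>n. c * (cmod (u (n + 0)))\<^sup>2) summable_on UNIV"
      by (rule summable_on_cmult_right[OF s])+
    have sf: "?f summable_on UNIV"
      by (intro summable_on_add sa sb sc)
    have sH: "(\<lambda>n. (cmod (H g \<alpha> lam \<omega> u n))\<^sup>2) summable_on UNIV"
      by (rule summable_on_comparison_test[OF sf]) (use le in auto)
    have ea: "(\<Sum>\<^sub>\<infinity>n. d * (cmod (u (n + k)))\<^sup>2) = d * ?N" for d k
      using l2_shift(2)[OF u, of k] by (simp add: infsum_cmult_right')
    have "(\<Sum>\<^sub>\<infinity>n. (cmod (H g \<alpha> lam \<omega> u n))\<^sup>2) \<le> infsum ?f UNIV"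
      by (rule infsum_mono[OF sH sf]) (rule le)
    also have "\<dots> = a * ?N + b * ?N + c * ?N"
      by (subst infsum_add[OF summable_on_add[OF sa sb] sc], subst infsum_add[OF sa sb]) (simp only: ea)
    also have "\<dots> = (a + b + c) * ?N" by (simp add: algebra_simps)
    finally have "l2_norm (H g \<alpha> lam \<omega> u) \<le> sqrt ((a + b + c) * ?N)"
      unfolding l2_norm_def by (rule real_sqrt_le_mono)
    with sH show ?thesis by (simp add: l2_def l2_norm_def real_sqrt_mult)
  qed
  then have "\<exists>C. \<forall>u\<in>l2. l2_norm (H g \<alpha> lam \<omega> u) \<le> C * l2_norm u" by blast
  with key show ?thesis
    unfolding bounded_op_def by (auto simp: H_def fun_eq_iff algebra_simps)
qed

end

theory Submission
  imports Defs
begin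

text \<open>Let \<open>S\<close> be the shift \<open>(S u) n = u (n - 1)\<close> and \<open>U\<close> the multiplication by \<open>cis (2 * pi * (\<omega> + n * \<alpha>))\<close>.
  Then \<open>U S = q S U\<close> with \<open>q = cis (2 * pi * \<alpha>)\<close>, and the operator is \<open>p(S) + lam U\<close> with the symbol
  \<open>p(w) = exp (- g) * w + exp g / w\<close>. In Fourier space \<open>S\<close> multiplies by \<open>w\<close> on the unit circle and \<open>U\<close>
  rotates the circle, so \<open>p(S) - z + lam U\<close> is a weighted irrational rotation. Such an operator
  should be invertible or not according to how \<open>\<bar>lam\<bar>\<close> compares with the geometric mean of
  \<open>\<bar>p - z\<bar>\<close> over the circle, and whether \<open>p - z\<close> has a zero there.

  Every \<open>z\<close> is \<open>p(\<zeta>)\<close> for some \<open>\<zeta>\<close> with \<open>\<bar>\<zeta>\<bar> \<le> exp (Re g)\<close>; the other solution is \<open>\<xi> = exp (2 g) / \<zeta>\<close>, and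
  \<open>p(w) - z = exp (- g) (w - \<zeta>) (w - \<xi>) / w\<close>. By Jensen's formula the geometric mean is
  \<open>exp (Re g) * max 1 (1 / \<bar>\<zeta>\<bar>)\<close>. The sets in the theorem consist of the \<open>z\<close> for which \<open>\<bar>lam\<bar>\<close> equals this
  mean, together with those with \<open>\<bar>\<zeta>\<bar> = 1\<close> and \<open>\<bar>lam\<bar> < exp (Re g)\<close>. The proof replaces the ergodic
  theorem by two explicit constructions.

  Outside these sets (\<open>not_in_spectrum\<close>) the operator is conjugated to one with an almost constant
  symbol. A factor \<open>1 - c S\<close> with \<open>\<bar>c\<bar> < 1\<close> is, up to a small error, the exponential of a polynomial in
  \<open>S\<close> without constant term, and such a polynomial is a coboundary \<open>\<psi>(q S) - \<psi>(S)\<close> because \<open>q\<close> is not a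
  root of unity (\<open>straighten_exactly\<close>). Multiplying by \<open>exp (- \<psi>(q S))\<close> on the left and
  \<open>exp (\<psi>(S))\<close> on the right removes the factor and leaves \<open>U\<close> unchanged. What remains is a constant,
  possibly times a power of \<open>S\<close>, plus \<open>lam U\<close>, up to a small error, and one of the two terms
  dominates. For \<open>\<bar>c\<bar> = 1\<close> the factor can still be given a norm arbitrarily close to \<open>1\<close>
  (\<open>straighten_small_norm\<close>), which is enough if \<open>lam U\<close> is the dominating term.

  Inside these sets (\<open>in_spectrum_if_resonant\<close>) there are approximate eigenvectors. If \<open>\<alpha>\<close> is replaced
  by a rational number \<open>a / q\<close> (from here on \<open>q\<close> is a denominator), Bloch waves exist as soon as the product of \<open>p - z\<close> over an orbit of
  the rational rotation has modulus \<open>\<bar>lam\<bar> ^ q\<close> and the right phase (\<open>bloch_wave\<close>). That product is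
  explicit, \<open>\<bar>w ^ q - \<zeta> ^ q\<bar> \<bar>w ^ q - \<xi> ^ q\<bar> exp (- q Re g)\<close> (\<open>prod_roots_of_unity\<close>), and exactly on the sets
  in question a starting point \<open>w\<close> can be found for which its modulus is right up to a negligible
  change of \<open>\<bar>lam\<bar>\<close>. The phase is adjusted by translation along \<open>\<int>\<close>. A Bloch wave for
  a good rational approximation of \<open>\<alpha>\<close>, cut off to many periods, is an approximate eigenvector
  (\<open>approximate_eigenvector_by_cutoff\<close>).\<close>

section \<open>Square summable sequences\<close>

text \<open>The norm of a sequence is the supremum of its Euclidean norms over finite index sets. The next two
  lemmas are the two halves of this; through them the triangle inequality and completeness come
  from the finite-dimensional case.\<close>

lemma l2_L2_set_le:
  assumes "u \<in> l2" and "finite F"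
  shows "L2_set (\<lambda>n. cmod (u n)) F \<le> l2_norm u"
proof -
  have "(\<Sum>n\<in>F. (cmod (u n))\<^sup>2) \<le> (\<Sum>\<^sub>\<infinity>n. (cmod (u n))\<^sup>2)"
    using assms by (intro finite_sum_le_infsum) (auto simp: l2_def)
  then show ?thesis
    unfolding L2_set_def l2_norm_def by (rule real_sqrt_le_mono)
qed

lemma l2I_L2_set:
  assumes "\<And>F. finite F \<Longrightarrow> L2_set (\<lambda>n. cmod (u n)) F \<le> C"
  shows "u \<in> l2" and "l2_norm u \<le> C"
proof -
  have C: "0 \<le> C" using assms[of "{}"] by simp
  have b: "(\<Sum>n\<in>F. (cmod (u n))\<^sup>2) \<le> C\<^sup>2" if "finite F" for F
    using assms[OF that] C by (simp add: L2_set_def sqrt_le_D)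
  have s: "(\<lambda>n. (cmod (u n))\<^sup>2) summable_on UNIV"
    by (rule nonneg_bdd_above_summable_on) (auto intro!: bdd_aboveI2[where M = "C\<^sup>2"] b)
  show "u \<in> l2" using s by (simp add: l2_def)
  have "(\<Sum>\<^sub>\<infinity>n. (cmod (u n))\<^sup>2) \<le> C\<^sup>2"
    by (rule infsum_le_finite_sums[OF s]) (simp add: b)
  then show "l2_norm u \<le> C"
    unfolding l2_norm_def using C by (simp add: real_le_lsqrt)
qed

lemma l2_norm_nonneg: "0 \<le> l2_norm u"
  by (simp add: l2_norm_def infsum_nonneg)

lemma cmod_le_l2_norm: "u \<in> l2 \<Longrightarrow> cmod (u n) \<le> l2_norm u"
  using l2_L2_set_le[of u "{n}"] by (simp add: L2_set_def)

lemma l2_add: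
  assumes "u \<in> l2" "v \<in> l2"
  shows "(\<lambda>n. u n + v n) \<in> l2" and "l2_norm (\<lambda>n. u n + v n) \<le> l2_norm u + l2_norm v"
proof -
  have "L2_set (\<lambda>n. cmod (u n + v n)) F \<le> l2_norm u + l2_norm v" if "finite F" for F
  proof -
    have "L2_set (\<lambda>n. cmod (u n + v n)) F \<le> L2_set (\<lambda>n. cmod (u n) + cmod (v n)) F"
      by (intro L2_set_mono norm_triangle_ineq) auto
    also have "\<dots> \<le> L2_set (\<lambda>n. cmod (u n)) F + L2_set (\<lambda>n. cmod (v n)) F"
      by (rule L2_set_triangle_ineq)
    also have "\<dots> \<le> l2_norm u + l2_norm v"
      using l2_L2_set_le assms that by (intro add_mono) auto
    finally show ?thesis .
  qed
  from l2I_L2_set[OF this]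
  show "(\<lambda>n. u n + v n) \<in> l2" and "l2_norm (\<lambda>n. u n + v n) \<le> l2_norm u + l2_norm v" by auto
qed

lemma l2_le:
  assumes "v \<in> l2" "0 \<le> C" "\<And>n. cmod (u n) \<le> C * cmod (v n)"
  shows "u \<in> l2" and "l2_norm u \<le> C * l2_norm v"
proof -
  have "L2_set (\<lambda>n. cmod (u n)) F \<le> C * l2_norm v" if "finite F" for F
  proof -
    have "L2_set (\<lambda>n. cmod (u n)) F \<le> L2_set (\<lambda>n. C * cmod (v n)) F"
      by (intro L2_set_mono assms) auto
    also have "\<dots> = C * L2_set (\<lambda>n. cmod (v n)) F"
      using assms by (simp add: L2_set_right_distrib)
    also have "\<dots> \<le> C * l2_norm v"
      using l2_L2_set_le assms that by (intro mult_left_mono) auto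
    finally show ?thesis .
  qed
  from l2I_L2_set[OF this] show "u \<in> l2" and "l2_norm u \<le> C * l2_norm v" by auto
qed

lemma l2_cmult:
  assumes "u \<in> l2"
  shows "(\<lambda>n. c * u n) \<in> l2" and "l2_norm (\<lambda>n. c * u n) = cmod c * l2_norm u"
proof -
  show "(\<lambda>n. c * u n) \<in> l2"
    using l2_le(1)[OF assms, of "cmod c" "\<lambda>n. c * u n"] by (simp add: norm_mult)
  show "l2_norm (\<lambda>n. c * u n) = cmod c * l2_norm u"
    unfolding l2_norm_def
    by (simp add: norm_mult power_mult_distrib infsum_cmult_right' real_sqrt_mult)
qed

lemma l2_minus:
  assumes "u \<in> l2" "v \<in> l2"
  shows "(\<lambda>n. u n - v n) \<in> l2" and "l2_norm (\<lambda>n. u n - v n) \<le> l2_norm u + l2_norm v"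
  using l2_add[OF assms(1) l2_cmult(1)[OF assms(2), of "-1"]] l2_cmult(2)[OF assms(2), of "-1"]
  by auto

lemma l2_zero: "(\<lambda>n. 0) \<in> l2"
  by (simp add: l2_def)

lemma l2_finite_support:
  assumes "finite {n. u n \<noteq> 0}"
  shows "u \<in> l2" and "(l2_norm u)\<^sup>2 = (\<Sum>n | u n \<noteq> 0. (cmod (u n))\<^sup>2)"
proof -
  let ?F = "{n. u n \<noteq> 0}"
  have s: "(\<lambda>n. (cmod (u n))\<^sup>2) summable_on UNIV"
    using summable_on_cong_neutral[of UNIV ?F "\<lambda>n. (cmod (u n))\<^sup>2" "\<lambda>n. (cmod (u n))\<^sup>2"]
      summable_on_finite[OF assms, of "\<lambda>n. (cmod (u n))\<^sup>2"] by auto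
  then show "u \<in> l2" by (simp add: l2_def)
  have "(\<Sum>\<^sub>\<infinity>n. (cmod (u n))\<^sup>2) = (\<Sum>\<^sub>\<infinity>n\<in>?F. (cmod (u n))\<^sup>2)"
    by (rule infsum_cong_neutral) auto
  also have "\<dots> = (\<Sum>n\<in>?F. (cmod (u n))\<^sup>2)"
    using assms by simp
  finally show "(l2_norm u)\<^sup>2 = (\<Sum>n\<in>?F. (cmod (u n))\<^sup>2)"
    by (simp add: l2_norm_def infsum_nonneg sum_nonneg)
qed

text \<open>Making the sequences a type of class \<open>banach\<close>, and the operators on it a Banach algebra, gives
  access to Neumann series and the exponential function for operators.\<close>

typedef ell2 = l2
  morphisms seq Ell2 using l2_zero by blast

setup_lifting type_definition_ell2

instantiation ell2 :: real_normed_vector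
begin

lift_definition zero_ell2 :: ell2 is "\<lambda>n. 0" by (rule l2_zero)
lift_definition plus_ell2 :: "ell2 \<Rightarrow> ell2 \<Rightarrow> ell2" is "\<lambda>u v n. u n + v n" by (rule l2_add)
lift_definition minus_ell2 :: "ell2 \<Rightarrow> ell2 \<Rightarrow> ell2" is "\<lambda>u v n. u n - v n" by (rule l2_minus)
lift_definition uminus_ell2 :: "ell2 \<Rightarrow> ell2" is "\<lambda>u n. - u n"
  using l2_cmult(1)[of _ "-1"] by simp
lift_definition scaleR_ell2 :: "real \<Rightarrow> ell2 \<Rightarrow> ell2" is "\<lambda>r u n. of_real r * u n"
  by (rule l2_cmult)
lift_definition norm_ell2 :: "ell2 \<Rightarrow> real" is l2_norm .

definition dist_ell2 :: "ell2 \<Rightarrow> ell2 \<Rightarrow> real" where "dist_ell2 u v = norm (u - v)"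
definition sgn_ell2 :: "ell2 \<Rightarrow> ell2" where "sgn_ell2 u = inverse (norm u) *\<^sub>R u"
definition uniformity_ell2 :: "(ell2 \<times> ell2) filter"
  where "uniformity_ell2 = (INF e\<in>{0 <..}. principal {(x, y). dist x y < e})"
definition open_ell2 :: "ell2 set \<Rightarrow> bool"
  where "open_ell2 A = (\<forall>x\<in>A. \<forall>\<^sub>F (x', y) in uniformity. x' = x \<longrightarrow> y \<in> A)"

instance
proof
  fix u v w :: ell2 and a b :: real
  show "u + v + w = u + (v + w)" by transfer (simp add: algebra_simps)
  show "u + v = v + u" by transfer (simp add: algebra_simps)
  show "0 + u = u" by transfer simp
  show "- u + u = 0" by transfer simp
  show "u - v = u + - v" by transfer simp
  show "a *\<^sub>R (u + v) = a *\<^sub>R u + a *\<^sub>R v" by transfer (simp add: algebra_simps)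
  show "(a + b) *\<^sub>R u = a *\<^sub>R u + b *\<^sub>R u" by transfer (simp add: algebra_simps)
  show "a *\<^sub>R b *\<^sub>R u = (a * b) *\<^sub>R u" by transfer (simp add: algebra_simps)
  show "1 *\<^sub>R u = u" by transfer simp
  show "norm (u + v) \<le> norm u + norm v" by transfer (rule l2_add)
  show "norm (a *\<^sub>R u) = \<bar>a\<bar> * norm u" by transfer (simp add: l2_cmult)
  show "(norm u = 0) = (u = 0)"
  proof transfer
    fix x assume x: "x \<in> l2"
    have "x = (\<lambda>n. 0)" if "l2_norm x = 0"
      using cmod_le_l2_norm[OF x] that by auto
    then show "(l2_norm x = 0) = (x = (\<lambda>n. 0))" by (auto simp: l2_norm_def)
  qed
qed (simp_all add: dist_ell2_def sgn_ell2_def uniformity_ell2_def open_ell2_def)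

end

lemma seq_in_l2 [simp]: "seq u \<in> l2" by (rule seq)

lemma seq_add: "seq (u + v) n = seq u n + seq v n" by transfer simp
lemma seq_minus: "seq (u - v) n = seq u n - seq v n" by transfer simp
lemma seq_scaleR: "seq (r *\<^sub>R u) n = of_real r * seq u n" by transfer simp
lemma norm_ell2_eq: "norm u = l2_norm (seq u)" by transfer simp
lemma ell2_eqI: "(\<And>n. seq u n = seq v n) \<Longrightarrow> u = v" by transfer auto

instance ell2 :: banach
proof
  fix X :: "nat \<Rightarrow> ell2"
  assume X: "Cauchy X"
  have co: "cmod (seq (X i) n - seq (X j) n) \<le> norm (X i - X j)" for i j n
    by (metis cmod_le_l2_norm norm_ell2_eq seq_in_l2 seq_minus)
  have "\<exists>l. (\<lambda>i. seq (X i) n) \<longlonglongrightarrow> l" for n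
  proof -
    have "Cauchy (\<lambda>i. seq (X i) n)"
      using X co unfolding Cauchy_def dist_norm by (meson le_less_trans)
    then show ?thesis using Cauchy_convergent convergentD by blast
  qed
  then obtain l where l: "\<And>n. (\<lambda>i. seq (X i) n) \<longlonglongrightarrow> l n" by metis
  \<comment> \<open>The pointwise limit \<open>l\<close> inherits the Cauchy estimate over each finite index set.\<close>
  have tail: "(\<lambda>n. seq (X i) n - l n) \<in> l2 \<and> l2_norm (\<lambda>n. seq (X i) n - l n) \<le> e"
    if e: "\<And>j. j \<ge> N \<Longrightarrow> norm (X i - X j) \<le> e" for i N e
  proof -
    have "L2_set (\<lambda>n. cmod (seq (X i) n - l n)) F \<le> e" if "finite F" for F
    proof -
      have lim: "(\<lambda>j. L2_set (\<lambda>n. cmod (seq (X i) n - seq (X j) n)) F)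
          \<longlonglongrightarrow> L2_set (\<lambda>n. cmod (seq (X i) n - l n)) F"
        unfolding L2_set_def by (intro tendsto_intros l)
      show ?thesis
      proof (rule LIMSEQ_le_const2[OF lim], intro exI[of _ N] allI impI)
        fix j assume "N \<le> j"
        have "L2_set (\<lambda>n. cmod (seq (X i) n - seq (X j) n)) F \<le> norm (X i - X j)"
          using l2_L2_set_le[OF seq_in_l2 that, of "X i - X j"]
          by (simp add: norm_ell2_eq seq_minus)
        then show "L2_set (\<lambda>n. cmod (seq (X i) n - seq (X j) n)) F \<le> e"
          using e[OF \<open>N \<le> j\<close>] by linarith
      qed
    qed
    from l2I_L2_set[OF this] show ?thesis by auto
  qed
  have ev: "\<exists>N. \<forall>i\<ge>N. \<forall>j\<ge>N. norm (X i - X j) \<le> e" if "0 < e" for e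
    using X that unfolding Cauchy_def dist_norm by (meson less_imp_le)
  obtain N0 where "\<forall>i\<ge>N0. \<forall>j\<ge>N0. norm (X i - X j) \<le> 1" using ev[of 1] by auto
  then have "(\<lambda>n. seq (X N0) n - l n) \<in> l2" using tail[of N0 N0 1] by auto
  from l2_minus(1)[OF seq_in_l2[of "X N0"] this] have "l \<in> l2" by simp
  then have sl: "seq (Ell2 l) = l" by (simp add: Ell2_inverse)
  have "X \<longlonglongrightarrow> Ell2 l"
  proof (rule LIMSEQ_I)
    fix e :: real assume "0 < e"
    then obtain N where N: "\<forall>i\<ge>N. \<forall>j\<ge>N. norm (X i - X j) \<le> e / 2"
      using ev[of "e / 2"] by auto
    have "norm (X i - Ell2 l) < e" if "i \<ge> N" for i
    proof -
      have "l2_norm (\<lambda>n. seq (X i) n - l n) \<le> e / 2"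
        using tail[of N i "e / 2"] N that by auto
      moreover have "seq (X i - Ell2 l) = (\<lambda>n. seq (X i) n - l n)"
        by (auto simp: seq_minus sl)
      ultimately show ?thesis using \<open>0 < e\<close> by (simp add: norm_ell2_eq)
    qed
    then show "\<exists>N. \<forall>i\<ge>N. norm (X i - Ell2 l) < e" by blast
  qed
  then show "convergent X" by (rule convergentI)
qed

section \<open>The Banach algebra of bounded operators\<close>

text \<open>A separate type is needed because the product of \<open>'a \<Rightarrow>\<^sub>L 'b\<close> is heterogeneous, so that the class of
  algebras cannot be instantiated there. The operators are only real linear; complex scalars
  enter below as operators of their own.\<close>

typedef op = "UNIV :: (ell2 \<Rightarrow>\<^sub>L ell2) set"
  morphisms blinfun_of Op by simp

setup_lifting type_definition_op

lemma ell2_nontrivial: "\<exists>u::ell2. u \<noteq> 0"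
proof -
  let ?d = "\<lambda>n::int. if n = 0 then 1 else 0 :: complex"
  have "?d \<in> l2" by (rule l2_finite_support) (simp add: if_distrib)
  then have "seq (Ell2 ?d) 0 \<noteq> 0" by (simp add: Ell2_inverse)
  moreover have "seq 0 0 = 0" by transfer simp
  ultimately show ?thesis by metis
qed

instantiation op :: real_normed_algebra_1
begin

lift_definition zero_op :: op is 0 .
lift_definition one_op :: op is id_blinfun .
lift_definition plus_op :: "op \<Rightarrow> op \<Rightarrow> op" is "(+)" .
lift_definition minus_op :: "op \<Rightarrow> op \<Rightarrow> op" is "(-)" .
lift_definition uminus_op :: "op \<Rightarrow> op" is uminus .
lift_definition times_op :: "op \<Rightarrow> op \<Rightarrow> op" is "(o\<^sub>L)" .
lift_definition scaleR_op :: "real \<Rightarrow> op \<Rightarrow> op" is "(*\<^sub>R)" .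
lift_definition norm_op :: "op \<Rightarrow> real" is norm .

definition dist_op :: "op \<Rightarrow> op \<Rightarrow> real" where "dist_op u v = norm (u - v)"
definition sgn_op :: "op \<Rightarrow> op" where "sgn_op u = inverse (norm u) *\<^sub>R u"
definition uniformity_op :: "(op \<times> op) filter"
  where "uniformity_op = (INF e\<in>{0 <..}. principal {(x, y). dist x y < e})"
definition open_op :: "op set \<Rightarrow> bool"
  where "open_op A = (\<forall>x\<in>A. \<forall>\<^sub>F (x', y) in uniformity. x' = x \<longrightarrow> y \<in> A)"

instance
proof
  obtain e :: ell2 where e: "e \<noteq> 0" using ell2_nontrivial by blast
  fix x y z :: op and a b :: real
  show "x + y + z = x + (y + z)" by transfer (simp add: algebra_simps)
  show "x + y = y + x" by transfer (simp add: algebra_simps)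
  show "0 + x = x" by transfer simp
  show "- x + x = 0" by transfer simp
  show "x - y = x + - y" by transfer simp
  show "a *\<^sub>R (x + y) = a *\<^sub>R x + a *\<^sub>R y" by transfer (simp add: algebra_simps)
  show "(a + b) *\<^sub>R x = a *\<^sub>R x + b *\<^sub>R x" by transfer (simp add: algebra_simps)
  show "a *\<^sub>R b *\<^sub>R x = (a * b) *\<^sub>R x" by transfer (simp add: algebra_simps)
  show "1 *\<^sub>R x = x" by transfer simp
  show "norm (x + y) \<le> norm x + norm y" by transfer (rule norm_triangle_ineq)
  show "norm (a *\<^sub>R x) = \<bar>a\<bar> * norm x" by transfer simp
  show "(norm x = 0) = (x = 0)" by transfer simp
  show "x * y * z = x * (y * z)" by transfer (rule blinfun_eqI, simp)
  show "1 * x = x" by transfer (rule blinfun_eqI, simp)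
  show "x * 1 = x" by transfer (rule blinfun_eqI, simp)
  show "(x + y) * z = x * z + y * z"
    by transfer (rule blinfun_eqI, simp add: blinfun.add_left)
  show "x * (y + z) = x * y + x * z"
    by transfer (rule blinfun_eqI, simp add: blinfun.add_left blinfun.add_right)
  show "a *\<^sub>R x * y = a *\<^sub>R (x * y)"
    by transfer (rule blinfun_eqI, simp add: blinfun.scaleR_left)
  show "x * a *\<^sub>R y = a *\<^sub>R (x * y)"
    by transfer (rule blinfun_eqI, simp add: blinfun.scaleR_left blinfun.scaleR_right)
  show "norm (x * y) \<le> norm x * norm y" by transfer (rule norm_blinfun_compose)
  show "(0::op) \<noteq> 1"
  proof transfer
    have "blinfun_apply (0 :: ell2 \<Rightarrow>\<^sub>L ell2) e \<noteq> blinfun_apply id_blinfun e" using e by simp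
    then show "(0 :: ell2 \<Rightarrow>\<^sub>L ell2) \<noteq> id_blinfun" by (rule contrapos_nn) (rule arg_cong)
  qed
  show "norm (1::op) = 1"
  proof transfer
    have "norm (blinfun_apply id_blinfun e) \<le> norm (id_blinfun :: ell2 \<Rightarrow>\<^sub>L ell2) * norm e"
      by (rule norm_blinfun)
    then have "1 \<le> norm (id_blinfun :: ell2 \<Rightarrow>\<^sub>L ell2)" using e by simp
    moreover have "norm (id_blinfun :: ell2 \<Rightarrow>\<^sub>L ell2) \<le> 1"
      by (rule norm_blinfun_bound) auto
    ultimately show "norm (id_blinfun :: ell2 \<Rightarrow>\<^sub>L ell2) = 1" by simp
  qed
qed (simp_all add: dist_op_def sgn_op_def uniformity_op_def open_op_def)

end

instance op :: banach
proof
  fix X :: "nat \<Rightarrow> op"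
  assume X: "Cauchy X"
  have d: "norm (x - y) = norm (blinfun_of x - blinfun_of y)" for x y by transfer simp
  have "Cauchy (\<lambda>i. blinfun_of (X i))"
    using X unfolding Cauchy_def dist_norm d .
  then obtain l where l: "(\<lambda>i. blinfun_of (X i)) \<longlonglongrightarrow> l"
    using Cauchy_convergent convergentD by blast
  have "X \<longlonglongrightarrow> Op l"
    using l unfolding LIMSEQ_def dist_norm d by (simp add: Op_inverse)
  then show "convergent X" by (rule convergentI)
qed

definition app :: "op \<Rightarrow> ell2 \<Rightarrow> ell2" where "app x = blinfun_apply (blinfun_of x)"

lemma app_add: "app (x + y) u = app x u + app y u"
  and app_minus: "app (x - y) u = app x u - app y u"
  and app_mult: "app (x * y) u = app x (app y u)"
  and app_one: "app 1 u = u"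
  and app_scaleR: "app (r *\<^sub>R x) u = r *\<^sub>R app x u"
  unfolding app_def
  by (transfer; simp add: blinfun.add_left blinfun.diff_left blinfun.scaleR_left)+

lemma app_add_right: "app x (u + v) = app x u + app x v"
  unfolding app_def by (simp add: blinfun.add_right)

lemma norm_app: "norm (app x u) \<le> norm x * norm u"
  unfolding app_def by transfer (rule norm_blinfun)

lemma norm_op_le: "0 \<le> C \<Longrightarrow> (\<And>u. norm (app x u) \<le> C * norm u) \<Longrightarrow> norm x \<le> C"
  unfolding app_def by transfer (rule norm_blinfun_bound)

lemma op_eqI: "(\<And>u. app x u = app y u) \<Longrightarrow> x = y"
  unfolding app_def by transfer (rule blinfun_eqI)

lemma op_exists:
  assumes "\<And>u v. f (u + v) = f u + f v" "\<And>r u. f (r *\<^sub>R u) = r *\<^sub>R f u"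
    and "\<And>u. norm (f u) \<le> C * norm u"
  shows "\<exists>x. app x = f"
proof -
  have "bounded_linear f"
    by (rule bounded_linear_intro[where K = C]) (use assms in \<open>auto simp: mult.commute\<close>)
  then have "app (Op (Blinfun f)) = f"
    by (simp add: app_def Op_inverse bounded_linear_Blinfun_apply)
  then show ?thesis by blast
qed

section \<open>Inverses and exponentials in Banach algebras\<close>

definition invertible_elt :: "'a::monoid_mult \<Rightarrow> bool" where
  "invertible_elt x \<longleftrightarrow> (\<exists>y. x * y = 1 \<and> y * x = 1)"

lemma invertible_elt_mult:
  assumes "invertible_elt x" "invertible_elt y"
  shows "invertible_elt (x * y)"
proof -
  obtain a b where a: "x * a = 1" "a * x = 1" and b: "y * b = 1" "b * y = 1"
    using assms unfolding invertible_elt_def by blast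
  have "x * y * (b * a) = x * (y * b) * a" "b * a * (x * y) = b * (a * x) * y"
    by (simp_all add: mult.assoc)
  then show ?thesis using a b unfolding invertible_elt_def by auto
qed

lemma invertible_elt_one_plus:
  fixes x :: "'a::{real_normed_algebra_1,banach}"
  assumes "norm x < 1"
  shows "invertible_elt (1 + x)"
proof -
  let ?s = "\<Sum>n. (- x) ^ n"
  have s: "summable (\<lambda>n. (- x) ^ n)"
    using complete_algebra_summable_geometric[of "- x"] assms by simp
  have h: "(\<Sum>n. (- x) ^ Suc n) = ?s - 1"
    using suminf_split_head[OF s] by simp
  have "- x * ?s = ?s - 1"
    using suminf_mult[OF s, of "- x"] unfolding power_Suc[symmetric] h by simp
  then have "(1 + x) * ?s = 1" by (simp add: algebra_simps)
  moreover have "?s * - x = ?s - 1"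
    using suminf_mult2[OF s, of "- x"] unfolding power_Suc2[symmetric] h by simp
  then have "?s * (1 + x) = 1" by (simp add: algebra_simps)
  ultimately show ?thesis unfolding invertible_elt_def by blast
qed

text \<open>With \<open>x = y\<close> this says that whatever commutes with \<open>x\<close> commutes with \<open>exp x\<close>; for the rotation
  \<open>u\<close> it says that passing \<open>u\<close> through a function of the shift rotates the argument.\<close>

lemma exp_intertwines:
  fixes u x y :: "'a::{real_normed_algebra_1,banach}"
  assumes "u * x = y * u"
  shows "u * exp x = exp y * u"
proof -
  have p: "u * x ^ n = y ^ n * u" for n
  proof (induction n)
    case (Suc n)
    have "u * x ^ Suc n = (u * x) * x ^ n" by (simp add: mult.assoc)
    also have "\<dots> = y * (u * x ^ n)" using assms by (simp add: mult.assoc)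
    finally show ?case using Suc by (simp add: mult.assoc)
  qed simp
  have "u * exp x = (\<Sum>n. u * (x ^ n /\<^sub>R fact n))"
    unfolding exp_def by (rule suminf_mult[symmetric, OF summable_exp_generic])
  also have "\<dots> = (\<Sum>n. (y ^ n /\<^sub>R fact n) * u)"
    by (simp add: p)
  also have "\<dots> = exp y * u"
    unfolding exp_def by (rule suminf_mult2[symmetric, OF summable_exp_generic])
  finally show ?thesis .
qed

text \<open>The Taylor polynomial of \<open>- ln (1 - x)\<close>.\<close>

definition truncated_log :: "nat \<Rightarrow> 'a::real_normed_algebra_1 \<Rightarrow> 'a" where
  "truncated_log M x = (\<Sum>m=1..M. (1 / real m) *\<^sub>R x ^ m)"

lemma truncated_log_power_commute: "x ^ k * truncated_log M (s *\<^sub>R x) = truncated_log M (s *\<^sub>R x) * x ^ k"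
  unfolding truncated_log_def by (simp add: sum_distrib_left sum_distrib_right flip: power_add)
    (simp add: add.commute)

text \<open>Only commuting factors \<open>exp ((t ^ m / m) *\<^sub>R x ^ m)\<close> occur, so the chain rule holds as for scalars
  although the algebra is not commutative.\<close>

lemma truncated_log_exp_derivative:
  fixes x :: "'a::{real_normed_algebra_1,banach}"
  shows "((\<lambda>t. exp (truncated_log M (t *\<^sub>R x))) has_vector_derivative
      (\<Sum>m<M. t ^ m *\<^sub>R x ^ Suc m) * exp (truncated_log M (t *\<^sub>R x))) (at t)"
proof (induction M)
  case 0
  then show ?case by (simp add: truncated_log_def)
next
  case (Suc M)
  let ?e = "\<lambda>t. exp ((t ^ Suc M / real (Suc M)) *\<^sub>R x ^ Suc M)"
  let ?g = "\<lambda>t. exp (truncated_log M (t *\<^sub>R x))"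
  have split: "exp (truncated_log (Suc M) (s *\<^sub>R x)) = ?g s * ?e s" for s
    unfolding truncated_log_def[of "Suc M"]
    using truncated_log_power_commute[of x "Suc M" M s]
    by (simp add: truncated_log_def exp_add_commuting del: power_Suc)
  have de: "(?e has_vector_derivative t ^ M *\<^sub>R (x ^ Suc M * ?e t)) (at t)"
  proof -
    have d: "((\<lambda>t. t ^ Suc M / real (Suc M)) has_real_derivative t ^ M) (at t)"
      by (rule derivative_eq_intros refl | simp)+
    have "(((\<lambda>s. exp (s *\<^sub>R x ^ Suc M)) \<circ> (\<lambda>t. t ^ Suc M / real (Suc M)))
        has_vector_derivative t ^ M *\<^sub>R (x ^ Suc M * ?e t)) (at t)"
      by (rule vector_diff_chain_at)
        (use d exp_scaleR_has_vector_derivative_left in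
          \<open>auto simp: has_real_derivative_iff_has_vector_derivative\<close>)
    then show ?thesis by (simp add: o_def)
  qed
  have "((\<lambda>t. ?g t * ?e t) has_vector_derivative
     ?g t * (t ^ M *\<^sub>R (x ^ Suc M * ?e t))
     + ((\<Sum>m<M. t ^ m *\<^sub>R x ^ Suc m) * ?g t) * ?e t) (at t)"
    by (rule has_vector_derivative_mult[OF Suc de])
  also have "?g t * (t ^ M *\<^sub>R (x ^ Suc M * ?e t)) = t ^ M *\<^sub>R x ^ Suc M * (?g t * ?e t)"
  proof -
    have "?g t * x ^ Suc M = x ^ Suc M * ?g t"
      by (rule exp_intertwines[symmetric]) (rule truncated_log_power_commute)
    then have "?g t * x ^ Suc M * ?e t = x ^ Suc M * ?g t * ?e t" by simp
    then show ?thesis by (simp only: mult_scaleR_left mult_scaleR_right mult.assoc)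
  qed
  finally show ?case
    unfolding split by (simp only: sum.lessThan_Suc distrib_right mult.assoc add.commute)
qed

text \<open>The product \<open>exp (truncated_log M x) * (1 - x)\<close> is the Weierstrass elementary factor of order \<open>M\<close>.
  Its derivative along the segment from \<open>0\<close> to \<open>x\<close> telescopes to \<open>- t ^ M *\<^sub>R (exp \<dots> * x ^ Suc M)\<close>,
  which is small; the mean value inequality then gives the bound. This avoids a logarithm in the
  Banach algebra.\<close>

lemma weierstrass_factor_bound:
  fixes x :: "'a::{real_normed_algebra_1,banach}"
  assumes r: "norm x \<le> r" "r < 1"
  shows "norm (exp (truncated_log M x) * (1 - x) - 1) \<le> r ^ Suc M * exp (1 / (1 - r))"
proof -
  let ?g = "\<lambda>t. exp (truncated_log M (t *\<^sub>R x))"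
  let ?F = "\<lambda>t. ?g t * (1 - t *\<^sub>R x)"
  let ?F' = "\<lambda>t. - (t ^ M *\<^sub>R (?g t * x ^ Suc M))"
  let ?C = "r ^ Suc M * exp (1 / (1 - r))"
  have r0: "0 \<le> r" using r norm_ge_zero order_trans by blast
  have tele: "(\<Sum>m<M. t ^ m *\<^sub>R x ^ Suc m) * (1 - t *\<^sub>R x) = x - t ^ M *\<^sub>R x ^ Suc M" for t M
  proof (induction M)
    case (Suc M)
    have "t ^ M *\<^sub>R x ^ Suc M * (1 - t *\<^sub>R x) = t ^ M *\<^sub>R x ^ Suc M - t ^ Suc M *\<^sub>R x ^ Suc (Suc M)"
      by (simp only: right_diff_distrib mult_scaleR_left mult_scaleR_right scaleR_scaleR
          power_Suc2[of x "Suc M"] mult_1_right power_Suc[of t M])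
    with Suc show ?case unfolding sum.lessThan_Suc distrib_right by simp
  qed simp
  have comm: "(\<Sum>m<M. t ^ m *\<^sub>R x ^ Suc m) * ?g t = ?g t * (\<Sum>m<M. t ^ m *\<^sub>R x ^ Suc m)" for t
    by (rule exp_intertwines)
      (simp only: sum_distrib_left sum_distrib_right mult_scaleR_left mult_scaleR_right
        truncated_log_power_commute)
  have dF: "(?F has_vector_derivative ?F' t) (at t)" for t
  proof -
    have "(?F has_vector_derivative
        ?g t * (- x) + ((\<Sum>m<M. t ^ m *\<^sub>R x ^ Suc m) * ?g t) * (1 - t *\<^sub>R x)) (at t)"
      by (intro has_vector_derivative_mult truncated_log_exp_derivative)
        (auto intro!: derivative_eq_intros)
    also have "((\<Sum>m<M. t ^ m *\<^sub>R x ^ Suc m) * ?g t) * (1 - t *\<^sub>R x)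
        = ?g t * (x - t ^ M *\<^sub>R x ^ Suc M)"
      unfolding comm mult.assoc tele ..
    finally show ?thesis by (simp add: algebra_simps)
  qed
  have gb: "norm (?F' t) \<le> ?C" if t: "0 < t" "t < 1" for t
  proof -
    have "norm (truncated_log M (t *\<^sub>R x)) \<le> (\<Sum>m=1..M. norm ((1 / real m) *\<^sub>R (t *\<^sub>R x) ^ m))"
      unfolding truncated_log_def by (rule norm_sum)
    also have "\<dots> \<le> (\<Sum>m=1..M. r ^ m)"
    proof (rule sum_mono)
      fix m assume m: "m \<in> {1..M}"
      have "norm ((t *\<^sub>R x) ^ m) \<le> norm (t *\<^sub>R x) ^ m" by (rule norm_power_ineq)
      also have "\<dots> \<le> r ^ m"
      proof (rule power_mono)
        show "norm (t *\<^sub>R x) \<le> r"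
          using r t mult_left_le_one_le[of "norm x" t] by simp
      qed simp
      finally have "norm ((t *\<^sub>R x) ^ m) \<le> r ^ m" .
      then have "(1 / real m) * norm ((t *\<^sub>R x) ^ m) \<le> 1 * r ^ m"
        by (intro mult_mono) (use m in auto)
      then show "norm ((1 / real m) *\<^sub>R (t *\<^sub>R x) ^ m) \<le> r ^ m"
        by simp
    qed
    also have "\<dots> \<le> (\<Sum>m. r ^ m)"
      by (rule sum_le_suminf) (use r r0 in \<open>auto intro: summable_geometric\<close>)
    also have "\<dots> = 1 / (1 - r)" by (rule suminf_geometric) (use r r0 in simp)
    finally have "norm (?g t) \<le> exp (1 / (1 - r))"
      using norm_exp[of "truncated_log M (t *\<^sub>R x)"] by (meson exp_le_cancel_iff order_trans)
    moreover have "norm (x ^ Suc M) \<le> r ^ Suc M"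
      by (rule order_trans[OF norm_power_ineq power_mono[OF r(1)]]) simp
    ultimately have "norm (?g t * x ^ Suc M) \<le> exp (1 / (1 - r)) * r ^ Suc M"
      by (intro order_trans[OF norm_mult_ineq] mult_mono) auto
    then have "t ^ M * norm (?g t * x ^ Suc M) \<le> 1 * (exp (1 / (1 - r)) * r ^ Suc M)"
      using t by (intro mult_mono) (auto simp: power_le_one)
    then show ?thesis using t by (simp add: mult.commute)
  qed
  have cF: "continuous_on {0..1} ?F"
    using dF by (meson continuous_at_imp_continuous_on has_vector_derivative_continuous)
  have "norm (?F 1 - ?F 0) \<le> ?C * 1 - ?C * 0"
    by (rule differentiable_bound_general[where f' = ?F' and \<phi>' = "\<lambda>_. ?C"])
      (use cF dF gb in \<open>auto intro!: continuous_intros derivative_eq_intros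
         simp: has_real_derivative_iff_has_vector_derivative[symmetric]\<close>)
  moreover have "truncated_log M (0 *\<^sub>R x) = 0"
    unfolding truncated_log_def by (intro sum.neutral) (auto simp: zero_power)
  ultimately show ?thesis by simp
qed

section \<open>Straightening functions of the shift against a rotation\<close>

text \<open>\<open>S\<close> stands for the shift or its inverse, \<open>U\<close> for the diagonal rotation, \<open>sc c\<close> for multiplication by
  the complex number \<open>c\<close>. The last assumption is the inequality
  \<open>\<bar>1 - w\<bar> \<le> 2 / (1 + s) \<bar>1 - s w\<bar>\<close> on the unit circle, transported to the unitary operator \<open>c S\<close>;
  it handles symbols with a zero on the circle.\<close>

locale skew_rotation =
  fixes sc :: "complex \<Rightarrow> 'a::{real_normed_algebra_1,banach}" and S U :: 'a and q :: complex
  assumes sc_add: "sc (a + b) = sc a + sc b"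
    and sc_mult: "sc (a * b) = sc a * sc b"
    and sc_of_real: "sc (of_real r) = r *\<^sub>R 1"
    and norm_sc: "norm (sc a) \<le> cmod a"
    and sc_S: "sc a * S = S * sc a"
    and sc_U: "sc a * U = U * sc a"
    and norm_S: "norm S \<le> 1"
    and U_S: "U * S = sc q * (S * U)"
    and q_nonroot: "m \<noteq> 0 \<Longrightarrow> q ^ m \<noteq> 1"
    and S_contraction: "cmod c = 1 \<Longrightarrow> 0 \<le> s \<Longrightarrow> s < 1 \<Longrightarrow>
      norm ((1 - sc c * S) * y) \<le> 2 / (1 + s) * norm ((1 - s *\<^sub>R (sc c * S)) * y)"
begin

text \<open>The double commutant of \<open>S\<close> and the scalars. It is commutative and closed under all operations
  that are used, in particular under \<open>exp\<close> and inverses, which makes it a convenient substitute for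
  an explicit functional calculus.\<close>

definition functions_of_S :: "'a set" where
  "functions_of_S = {x. \<forall>y. y * S = S * y \<and> (\<forall>c. y * sc c = sc c * y) \<longrightarrow> x * y = y * x}"

lemma sc_1: "sc 1 = 1"
  using sc_of_real[of 1] by simp

lemma sc_comm: "sc a * sc b = sc b * sc a"
  by (metis mult.commute sc_mult)

lemma sc_power: "sc (a ^ n) = sc a ^ n"
  by (induction n) (auto simp: sc_1 sc_mult)

lemma sc_diff: "sc (a - b) = sc a - sc b"
  using sc_add[of "a - b" b] by (simp add: algebra_simps)

lemma fS_I:
  assumes "\<And>y. y * S = S * y \<Longrightarrow> (\<And>c. y * sc c = sc c * y) \<Longrightarrow> x * y = y * x"
  shows "x \<in> functions_of_S"
  using assms unfolding functions_of_S_def by blast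

lemma fS_D:
  assumes "x \<in> functions_of_S" "y * S = S * y" "\<And>c. y * sc c = sc c * y"
  shows "x * y = y * x"
  using assms unfolding functions_of_S_def by blast

lemma S_fS: "S \<in> functions_of_S" and sc_fS: "sc c \<in> functions_of_S"
  and one_fS: "1 \<in> functions_of_S"
  by (auto intro!: fS_I)

lemma fS_comm:
  assumes "x \<in> functions_of_S" "y \<in> functions_of_S"
  shows "x * y = y * x"
proof (rule fS_D[OF assms(1)])
  show "y * S = S * y" by (rule fS_D[OF assms(2)]) (simp_all add: sc_S)
  show "y * sc c = sc c * y" for c by (rule fS_D[OF assms(2)]) (simp_all add: sc_S sc_comm)
qed

lemma fS_diff:
  assumes "x \<in> functions_of_S" "y \<in> functions_of_S"
  shows "x - y \<in> functions_of_S"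
proof (rule fS_I)
  fix z assume z: "z * S = S * z" "\<And>c. z * sc c = sc c * z"
  show "(x - y) * z = z * (x - y)"
    using fS_D[OF assms(1) z] fS_D[OF assms(2) z] by (simp only: left_diff_distrib right_diff_distrib)
qed

lemma fS_mult:
  assumes "x \<in> functions_of_S" "y \<in> functions_of_S"
  shows "x * y \<in> functions_of_S"
proof (rule fS_I)
  fix z assume z: "z * S = S * z" "\<And>c. z * sc c = sc c * z"
  have "x * y * z = x * (y * z)" by (simp only: mult.assoc)
  also have "y * z = z * y" by (rule fS_D[OF assms(2) z])
  also have "x * (z * y) = (x * z) * y" by (simp only: mult.assoc)
  also have "x * z = z * x" by (rule fS_D[OF assms(1) z])
  also have "z * x * y = z * (x * y)" by (simp only: mult.assoc)
  finally show "x * y * z = z * (x * y)" by (simp add: mult.assoc)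
qed

lemma fS_power: "x \<in> functions_of_S \<Longrightarrow> x ^ n \<in> functions_of_S"
  by (induction n) (auto intro: fS_mult one_fS)

lemma fS_sum:
  assumes "\<And>i. i \<in> A \<Longrightarrow> f i \<in> functions_of_S"
  shows "sum f A \<in> functions_of_S"
proof (rule fS_I)
  fix z assume z: "z * S = S * z" "\<And>c. z * sc c = sc c * z"
  show "sum f A * z = z * sum f A"
    unfolding sum_distrib_left sum_distrib_right
    by (rule sum.cong[OF refl]) (rule fS_D[OF assms z])
qed

lemma fS_exp:
  assumes "x \<in> functions_of_S"
  shows "exp x \<in> functions_of_S"
proof (rule fS_I)
  fix z assume z: "z * S = S * z" "\<And>c. z * sc c = sc c * z"
  show "exp x * z = z * exp x"
    by (rule exp_intertwines[symmetric]) (rule fS_D[OF assms z, symmetric])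
qed

lemma fS_inverse:
  assumes "x \<in> functions_of_S" "x * y = 1" "y * x = 1"
  shows "y \<in> functions_of_S"
proof (rule fS_I)
  fix z assume z: "z * S = S * z" "\<And>c. z * sc c = sc c * z"
  have "y * z = y * z * (x * y)" by (simp add: assms)
  also have "\<dots> = y * (z * x) * y" by (simp only: mult.assoc)
  also have "z * x = x * z" by (rule fS_D[OF assms(1) z, symmetric])
  also have "y * (x * z) * y = (y * x) * (z * y)" by (simp only: mult.assoc)
  also have "\<dots> = z * y" by (simp add: assms)
  finally show "y * z = z * y" .
qed

text \<open>The relation \<open>U * X = Y * U\<close> expresses that \<open>X = x(S)\<close> and \<open>Y = x(q S)\<close> for one function \<open>x\<close>. So \<open>Q\<close> is
  \<open>P\<close> divided by the multiplicative coboundary \<open>x(q S) / x(S)\<close>.\<close>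

definition straightens :: "'a \<Rightarrow> 'a \<Rightarrow> bool" where
  "straightens P Q \<longleftrightarrow> Q \<in> functions_of_S \<and> (\<exists>X\<in>functions_of_S. \<exists>Y\<in>functions_of_S.
     invertible_elt X \<and> invertible_elt Y \<and> U * X = Y * U \<and> P * X = Y * Q)"

text \<open>Straightening is compatible with products because all the elements involved are functions of \<open>S\<close>
  and so commute.\<close>

lemma straightens_mult:
  assumes "straightens P1 Q1" "straightens P2 Q2"
  shows "straightens (P1 * P2) (Q1 * Q2)"
proof -
  obtain X1 Y1 where 1: "X1 \<in> functions_of_S" "Y1 \<in> functions_of_S" "invertible_elt X1"
    "invertible_elt Y1" "U * X1 = Y1 * U" "P1 * X1 = Y1 * Q1"
    using assms unfolding straightens_def by blast
  obtain X2 Y2 where 2: "X2 \<in> functions_of_S" "Y2 \<in> functions_of_S" "invertible_elt X2"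
    "invertible_elt Y2" "U * X2 = Y2 * U" "P2 * X2 = Y2 * Q2"
    using assms unfolding straightens_def by blast
  have Q: "Q1 \<in> functions_of_S" "Q2 \<in> functions_of_S"
    using assms unfolding straightens_def by auto
  have "U * (X2 * X1) = (U * X2) * X1" by (simp only: mult.assoc)
  also have "\<dots> = Y2 * (U * X1)" unfolding 2(5) by (simp only: mult.assoc)
  also have "\<dots> = Y2 * Y1 * U" unfolding 1(5) by (simp only: mult.assoc)
  finally have u: "U * (X2 * X1) = Y2 * Y1 * U" .
  have "P1 * P2 * (X2 * X1) = P1 * ((P2 * X2) * X1)" by (simp only: mult.assoc)
  also have "(P2 * X2) * X1 = X1 * (Y2 * Q2)"
    unfolding 2(6) by (rule fS_comm) (use 1 2 Q in \<open>auto intro: fS_mult\<close>)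
  also have "P1 * (X1 * (Y2 * Q2)) = (P1 * X1) * (Y2 * Q2)" by (simp only: mult.assoc)
  also have "\<dots> = Y1 * (Q1 * Y2) * Q2" unfolding 1(6) by (simp only: mult.assoc)
  also have "Q1 * Y2 = Y2 * Q1" using Q 2 by (intro fS_comm)
  also have "Y1 * (Y2 * Q1) * Q2 = (Y1 * Y2) * (Q1 * Q2)" by (simp only: mult.assoc)
  also have "Y1 * Y2 = Y2 * Y1" using 1 2 by (intro fS_comm)
  finally have "P1 * P2 * (X2 * X1) = Y2 * Y1 * (Q1 * Q2)" .
  with u 1 2 Q show ?thesis
    unfolding straightens_def
    by (intro conjI bexI[of _ "X2 * X1"] bexI[of _ "Y2 * Y1"] fS_mult invertible_elt_mult)
qed

lemma U_S_power: "U * S ^ m = sc (q ^ m) * (S ^ m * U)"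
proof (induction m)
  case (Suc m)
  have c: "S ^ m * sc q = sc q * S ^ m" by (intro fS_comm fS_power S_fS sc_fS)
  have "U * S ^ Suc m = (U * S ^ m) * S" by (simp only: power_Suc2 mult.assoc)
  also have "\<dots> = sc (q ^ m) * (S ^ m * (U * S))" unfolding Suc by (simp only: mult.assoc)
  also have "\<dots> = sc (q ^ m) * ((S ^ m * sc q) * (S * U))" unfolding U_S by (simp only: mult.assoc)
  also have "\<dots> = (sc (q ^ m) * sc q) * ((S ^ m * S) * U)" unfolding c by (simp only: mult.assoc)
  finally show ?case by (simp only: power_Suc2 sc_mult)
qed (simp add: sc_1)

lemma sc_S_power: "sc c ^ m * S ^ m = (sc c * S) ^ m"
proof (induction m)
  case (Suc m)
  have "sc c ^ Suc m * S ^ Suc m = sc c * (sc c ^ m * S) * S ^ m" by (simp add: mult.assoc)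
  also have "sc c ^ m * S = S * sc c ^ m" by (intro fS_comm fS_power S_fS sc_fS)
  also have "sc c * (S * sc c ^ m) * S ^ m = (sc c * S) * (sc c ^ m * S ^ m)"
    by (simp add: mult.assoc)
  finally show ?case by (simp add: Suc)
qed simp

text \<open>The cohomological equation \<open>p(x) - p(q x) = c x + (c x)\<^sup>2 / 2 + \<dots> + (c x) ^ M / M\<close> is solved
  coefficient by coefficient; thanks to the truncation only finitely many small divisors
  \<open>1 - q ^ m\<close> occur, none of which is zero.\<close>

lemma straighten_exactly:
  "straightens (1 - sc c * S) (exp (truncated_log M (sc c * S)) * (1 - sc c * S))"
proof -
  let ?x = "sc c * S"
  define b where "b m = c ^ m / (of_nat m * (1 - q ^ m))" for m
  define p where "p = (\<Sum>m=1..M. sc (b m) * S ^ m)"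
  define p' where "p' = (\<Sum>m=1..M. sc (b m * q ^ m) * S ^ m)"
  have fp: "p \<in> functions_of_S" "p' \<in> functions_of_S"
    unfolding p_def p'_def by (auto intro!: fS_sum fS_mult fS_power S_fS sc_fS)
  have x: "?x \<in> functions_of_S" by (intro fS_mult S_fS sc_fS)
  have diff: "p - p' = truncated_log M ?x"
    unfolding p_def p'_def truncated_log_def sum_subtractf[symmetric]
  proof (rule sum.cong[OF refl])
    fix m assume m: "m \<in> {1..M}"
    have "sc (b m) * S ^ m - sc (b m * q ^ m) * S ^ m = sc (b m * (1 - q ^ m)) * S ^ m"
      by (simp add: sc_diff right_diff_distrib left_diff_distrib)
    also have "b m * (1 - q ^ m) = of_real (1 / real m) * c ^ m"
      using q_nonroot[of m] m by (simp add: b_def)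
    also have "sc (of_real (1 / real m) * c ^ m) * S ^ m = (1 / real m) *\<^sub>R (sc c ^ m * S ^ m)"
      unfolding sc_mult sc_of_real sc_power by simp
    also have "sc c ^ m * S ^ m = ?x ^ m"
      by (rule sc_S_power)
    finally show "sc (b m) * S ^ m - sc (b m * q ^ m) * S ^ m = (1 / real m) *\<^sub>R ?x ^ m" .
  qed
  have up: "U * p = p' * U"
    unfolding p_def p'_def sum_distrib_left sum_distrib_right
  proof (rule sum.cong[OF refl])
    fix m
    have "U * (sc (b m) * S ^ m) = (sc (b m) * U) * S ^ m"
      by (simp only: sc_U mult.assoc)
    also have "\<dots> = sc (b m) * (U * S ^ m)" by (simp only: mult.assoc)
    finally show "U * (sc (b m) * S ^ m) = sc (b m * q ^ m) * S ^ m * U"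
      by (simp only: U_S_power sc_mult mult.assoc)
  qed
  have inv: "invertible_elt (exp z)" for z :: 'a
    unfolding invertible_elt_def
    using exp_minus_inverse[of z] exp_minus_inverse[of "- z"] by auto
  have "exp p = exp (p' + truncated_log M ?x)" by (simp add: diff[symmetric])
  also have "\<dots> = exp p' * exp (truncated_log M ?x)"
    by (rule exp_add_commuting, rule fS_comm) (use fp diff[symmetric] in \<open>auto intro: fS_diff\<close>)
  finally have e: "exp p = exp p' * exp (truncated_log M ?x)" .
  have "(1 - ?x) * exp p = exp p * (1 - ?x)"
    by (intro fS_comm fS_exp fp fS_diff one_fS x)
  also have "\<dots> = exp p' * (exp (truncated_log M ?x) * (1 - ?x))"
    unfolding e by (simp add: mult.assoc)
  finally have "(1 - ?x) * exp p = exp p' * (exp (truncated_log M ?x) * (1 - ?x))" .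
  moreover have "exp (truncated_log M ?x) * (1 - ?x) \<in> functions_of_S"
    unfolding diff[symmetric] by (intro fS_mult fS_exp fS_diff fp one_fS x)
  ultimately show ?thesis
    using exp_intertwines[OF up] inv fp
    unfolding straightens_def
    by (intro conjI bexI[of _ "exp p"] bexI[of _ "exp p'"] fS_exp)
qed

lemma straighten_near_one:
  assumes "cmod c < 1" "0 < e"
  obtains Q where "straightens (1 - sc c * S) Q" "norm (Q - 1) \<le> e"
proof -
  have x: "norm (sc c * S) \<le> cmod c"
    using order_trans[OF norm_mult_ineq mult_mono[OF norm_sc norm_S]] by simp
  have "(\<lambda>M. cmod c ^ Suc M) \<longlonglongrightarrow> 0"
    by (rule LIMSEQ_Suc, rule LIMSEQ_power_zero) (use assms in simp)
  then have "(\<lambda>M. cmod c ^ Suc M * exp (1 / (1 - cmod c))) \<longlonglongrightarrow> 0"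
    by (rule tendsto_mult_left_zero)
  then have "\<forall>\<^sub>F M in sequentially. cmod c ^ Suc M * exp (1 / (1 - cmod c)) < e"
    using assms(2) by (intro order_tendstoD) auto
  then obtain M where M: "cmod c ^ Suc M * exp (1 / (1 - cmod c)) < e"
    by (meson eventually_sequentially order_refl)
  then have "norm (exp (truncated_log M (sc c * S)) * (1 - sc c * S) - 1) \<le> e"
    using weierstrass_factor_bound[OF x assms(1), of M] by simp
  then show ?thesis using that straighten_exactly[of c M] by blast
qed

text \<open>If \<open>\<bar>c\<bar> = 1\<close>, the factor \<open>1 - c S\<close> is written as \<open>B (1 - s c S)\<close> with \<open>s < 1\<close>. The second factor can be
  straightened to something near \<open>1\<close>, and \<open>B\<close> has norm at most \<open>2 / (1 + s)\<close>, which tends to \<open>1\<close>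
  as \<open>s\<close> does.\<close>

lemma straighten_small_norm:
  assumes "cmod c \<le> 1" "0 < e"
  obtains Q where "straightens (1 - sc c * S) Q" "norm Q \<le> 1 + e"
proof (cases "cmod c < 1")
  case True
  then obtain Q where Q: "straightens (1 - sc c * S) Q" "norm (Q - 1) \<le> e"
    using straighten_near_one assms by blast
  then have "norm Q \<le> 1 + e" using norm_triangle_sub[of Q 1] by simp
  with Q that show ?thesis by blast
next
  case False
  with assms have c: "cmod c = 1" by simp
  have "((\<lambda>s. 2 / (1 + s) * (1 + (1 - s))) \<longlongrightarrow> 2 / (1 + 1) * (1 + (1 - 1))) (at_left (1::real))"
    by (intro tendsto_intros) auto
  then have "\<forall>\<^sub>F s in at_left (1::real). 2 / (1 + s) * (1 + (1 - s)) < 1 + e"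
    using assms(2) by (intro order_tendstoD(2)[where y = "2 / (1 + 1) * (1 + (1 - 1))"]) auto
  moreover have "\<forall>\<^sub>F s in at_left (1::real). s \<in> {0<..<1}"
    by (rule eventually_at_leftI[of 0]) auto
  ultimately have "\<forall>\<^sub>F s in at_left (1::real). 2 / (1 + s) * (1 + (1 - s)) < 1 + e \<and> s \<in> {0<..<1}"
    by (rule eventually_conj)
  then obtain s :: real where s: "2 / (1 + s) * (1 + (1 - s)) < 1 + e" "0 < s" "s < 1"
    using eventually_happens[of _ "at_left (1::real)"] by (auto simp: trivial_limit_at_left_real)
  define x where "x = sc (of_real s * c) * S"
  have xs: "x = s *\<^sub>R (sc c * S)" unfolding x_def sc_mult sc_of_real by simp
  have cs: "cmod (of_real s * c) = s" using s c by (simp add: norm_mult)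
  obtain Q where Q: "straightens (1 - x) Q" "norm (Q - 1) \<le> 1 - s"
    using straighten_near_one[of "of_real s * c" "1 - s"] s cs unfolding x_def by auto
  have "norm x \<le> cmod (of_real s * c) * 1"
    unfolding x_def by (intro order_trans[OF norm_mult_ineq] mult_mono norm_sc norm_S) auto
  then have "norm x \<le> s" by (simp add: cs)
  then have "invertible_elt (1 - x)"
    using invertible_elt_one_plus[of "- x"] s by simp
  then obtain R where R: "(1 - x) * R = 1" "R * (1 - x) = 1"
    unfolding invertible_elt_def by blast
  define B where "B = (1 - sc c * S) * R"
  have fB: "B \<in> functions_of_S"
    unfolding B_def
    by (intro fS_mult fS_diff one_fS S_fS sc_fS fS_inverse[OF _ R(1) R(2)])
      (simp_all add: x_def fS_mult fS_diff one_fS S_fS sc_fS)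
  have "norm B \<le> 2 / (1 + s) * norm ((1 - x) * R)"
    unfolding B_def xs by (rule S_contraction) (use c s in auto)
  then have nB: "norm B \<le> 2 / (1 + s)" by (simp add: R)
  have "straightens B B"
    unfolding straightens_def
    by (intro conjI bexI[of _ 1] fB one_fS) (auto simp: invertible_elt_def)
  from straightens_mult[OF this Q(1)] have "straightens (B * (1 - x)) (B * Q)" .
  moreover have "B * (1 - x) = 1 - sc c * S"
    unfolding B_def using R by (simp add: mult.assoc)
  moreover have "norm (B * Q) \<le> 1 + e"
  proof -
    have "norm Q \<le> 1 + (1 - s)" using norm_triangle_sub[of Q 1] Q(2) by simp
    then have "norm (B * Q) \<le> 2 / (1 + s) * (1 + (1 - s))"
      by (intro order_trans[OF norm_mult_ineq] mult_mono nB) (use s in auto)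
    then show ?thesis using s by simp
  qed
  ultimately show ?thesis using that[of "B * Q"] by simp
qed

text \<open>Conjugation: \<open>Y\<^sup>-\<^sup>1 (V P + lam U) X = V Q + lam U\<close>.\<close>

lemma straightens_invertible:
  assumes P: "straightens P Q" and V: "V \<in> functions_of_S"
    and I: "invertible_elt (V * Q + sc lam * U)"
  shows "invertible_elt (V * P + sc lam * U)"
proof -
  obtain X Y where XY: "X \<in> functions_of_S" "Y \<in> functions_of_S" "invertible_elt X"
    "invertible_elt Y" "U * X = Y * U" "P * X = Y * Q"
    using P unfolding straightens_def by blast
  obtain Xi where Xi: "X * Xi = 1" "Xi * X = 1" using XY(3) unfolding invertible_elt_def by blast
  have "(V * P + sc lam * U) * X = (V * Y) * Q + (sc lam * Y) * U"
  proof -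
    have "(V * P + sc lam * U) * X = V * (P * X) + sc lam * (U * X)"
      by (simp only: distrib_right mult.assoc)
    then show ?thesis unfolding XY(5,6) by (simp only: mult.assoc)
  qed
  also have "V * Y = Y * V" using XY V by (intro fS_comm)
  also have "sc lam * Y = Y * sc lam" using XY by (intro fS_comm sc_fS)
  finally have "(V * P + sc lam * U) * X = Y * (V * Q + sc lam * U)"
    by (simp only: distrib_left mult.assoc)
  then have "Y * (V * Q + sc lam * U) * Xi = (V * P + sc lam * U) * X * Xi"
    by simp
  also have "\<dots> = (V * P + sc lam * U) * (X * Xi)" by (rule mult.assoc)
  finally have "Y * (V * Q + sc lam * U) * Xi = (V * P + sc lam * U) * (X * Xi)" .
  then have "V * P + sc lam * U = Y * (V * Q + sc lam * U) * Xi"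
    unfolding Xi(1) by simp
  moreover have "invertible_elt Xi" using Xi unfolding invertible_elt_def by blast
  ultimately show ?thesis
    using XY(4) I by (simp add: invertible_elt_mult)
qed

end

locale skew_rotation_pair = skew_rotation sc S U q + inv: skew_rotation sc T U "inverse q"
  for sc :: "complex \<Rightarrow> 'a::{real_normed_algebra_1,banach}" and S T U :: 'a and q +
  fixes W :: 'a
  assumes S_T: "S * T = 1" and T_S: "T * S = 1"
    and W_U: "W * U = 1" and U_W: "U * W = 1" and norm_U: "norm U \<le> 1" and norm_W: "norm W \<le> 1"
begin

text \<open>An element commutes with \<open>S\<close> if and only if it commutes with the inverse \<open>T\<close>. Hence factors
  \<open>1 - c S\<close> and \<open>1 - c T\<close> can be straightened simultaneously.\<close>

lemma functions_of_inverse: "inv.functions_of_S = functions_of_S"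
proof -
  have "y * S = S * y \<longleftrightarrow> y * T = T * y" for y
  proof
    assume a: "y * S = S * y"
    have "y * T = T * (S * y) * T" by (simp add: T_S flip: mult.assoc)
    also have "\<dots> = T * y * (S * T)" unfolding a[symmetric] by (simp only: mult.assoc)
    finally show "y * T = T * y" by (simp add: S_T)
  next
    assume a: "y * T = T * y"
    have "y * S = S * (T * y) * S" by (simp add: S_T flip: mult.assoc)
    also have "\<dots> = S * y * (T * S)" unfolding a[symmetric] by (simp only: mult.assoc)
    finally show "y * S = S * y" by (simp add: T_S)
  qed
  then show ?thesis unfolding functions_of_S_def inv.functions_of_S_def by simp
qed

lemma straightens_inverse: "inv.straightens = straightens"
  unfolding straightens_def inv.straightens_def functions_of_inverse ..

lemma T_fS: "T \<in> functions_of_S"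
  using inv.S_fS by (simp add: functions_of_inverse)

text \<open>After straightening both factors to elements near \<open>1\<close>, the operator is \<open>V (1 + small + V' lam U)\<close>
  with a perturbation of norm less than \<open>1\<close>.\<close>

lemma skew_invertible_if_symbol_dominates:
  assumes S': "S' = S \<or> S' = T" and c: "cmod c < 1" "cmod c' < 1"
    and V: "V \<in> functions_of_S" "V * V' = 1" "V' * V = 1" and lam: "norm V' * cmod lam < 1"
  shows "invertible_elt (V * ((1 - sc c * S) * (1 - sc c' * S')) + sc lam * U)"
proof -
  \<comment> \<open>The product of two elements within \<open>e\<close> of \<open>1\<close> is within \<open>3 * e\<close> of \<open>1\<close>, which leaves room.\<close>
  define e where "e = (1 - norm V' * cmod lam) / 4"
  have e: "0 < e" "e \<le> 1" "norm V' * cmod lam = 1 - 4 * e"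
    using lam mult_nonneg_nonneg[of "norm V'" "cmod lam"] unfolding e_def by (simp_all add: field_simps)
  obtain Q where Q: "straightens (1 - sc c * S) Q" "norm (Q - 1) \<le> e"
    using straighten_near_one[OF c(1) e(1)] .
  obtain Q' where Q': "straightens (1 - sc c' * S') Q'" "norm (Q' - 1) \<le> e"
    using S' straighten_near_one[OF c(2) e(1)] inv.straighten_near_one[OF c(2) e(1)]
    unfolding straightens_inverse by metis
  have "norm (Q * Q' - 1) = norm ((Q - 1) * (Q' - 1) + (Q - 1) + (Q' - 1))"
    by (simp add: algebra_simps)
  also have "\<dots> \<le> norm ((Q - 1) * (Q' - 1)) + norm (Q - 1) + norm (Q' - 1)"
    by (meson add_mono norm_triangle_ineq norm_triangle_mono order_refl)
  also have "norm ((Q - 1) * (Q' - 1)) \<le> e * 1"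
    by (rule order_trans[OF norm_mult_ineq]) (intro mult_mono, use Q Q' e in auto)
  finally have QQ: "norm (Q * Q' - 1) \<le> 3 * e" using Q Q' by simp
  have "norm (V' * (sc lam * U)) \<le> norm V' * (cmod lam * 1)"
    by (intro order_trans[OF norm_mult_ineq] mult_mono norm_sc norm_U) auto
  then have "norm ((Q * Q' - 1) + V' * (sc lam * U)) < 1"
    using norm_triangle_ineq[of "Q * Q' - 1" "V' * (sc lam * U)"] QQ e by simp
  then have I: "invertible_elt (1 + ((Q * Q' - 1) + V' * (sc lam * U)))"
    by (rule invertible_elt_one_plus)
  have "V * (1 + ((Q * Q' - 1) + V' * (sc lam * U))) = V * (Q * Q') + (V * V') * (sc lam * U)"
    by (simp add: distrib_left mult.assoc)
  also have "\<dots> = V * (Q * Q') + sc lam * U" using V by simp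
  finally have "invertible_elt (V * (Q * Q') + sc lam * U)"
    using invertible_elt_mult[OF _ I, of V] V unfolding invertible_elt_def[of V] by auto
  with straightens_invertible[OF straightens_mult[OF Q(1) Q'(1)] V(1)] show ?thesis .
qed

text \<open>Now \<open>lam U\<close> is factored out instead, and of the straightened factors only the norms matter; zeros of
  the symbol on the unit circle do no harm.\<close>

lemma skew_invertible_if_rotation_dominates:
  assumes S': "S' = S \<or> S' = T" and c: "cmod c \<le> 1" "cmod c' \<le> 1"
    and V: "V \<in> functions_of_S" "norm V < cmod lam"
  shows "invertible_elt (V * ((1 - sc c * S) * (1 - sc c' * S')) + sc lam * U)"
proof -
  define r where "r = norm V / cmod lam"
  have lam: "0 < cmod lam" using V(2) norm_ge_zero[of V] by linarith
  have r: "0 \<le> r" "r < 1" using V(2) lam by (auto simp: r_def)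
  \<comment> \<open>This choice makes \<open>r * (1 + e)\<^sup>2 < 1\<close>.\<close>
  define e where "e = (1 - r) / 4"
  have e: "0 < e" "e \<le> 1 / 4" "r = 1 - 4 * e"
    using r by (simp_all add: e_def field_simps)
  obtain Q where Q: "straightens (1 - sc c * S) Q" "norm Q \<le> 1 + e"
    using straighten_small_norm[OF c(1) e(1)] .
  obtain Q' where Q': "straightens (1 - sc c' * S') Q'" "norm Q' \<le> 1 + e"
    using S' straighten_small_norm[OF c(2) e(1)] inv.straighten_small_norm[OF c(2) e(1)]
    unfolding straightens_inverse by metis
  let ?i = "W * (sc (1 / lam) * (V * (Q * Q')))"
  have "norm ?i \<le> 1 * (cmod (1 / lam) * (norm V * ((1 + e) * (1 + e))))"
    using Q(2) Q'(2) e(1)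
    by (intro order_trans[OF norm_mult_ineq] mult_mono norm_sc norm_W) auto
  also have "\<dots> = r * (1 + e)\<^sup>2"
    by (simp add: r_def norm_divide power2_eq_square)
  also have "\<dots> < 1"
  proof -
    have "r * (1 + e)\<^sup>2 = 1 - 2 * e - 7 * e\<^sup>2 - 4 * e ^ 3"
      unfolding e(3) by (simp add: power2_eq_square power3_eq_cube algebra_simps)
    then show ?thesis using e(1) zero_le_power[of e 3] zero_le_power2[of e] by linarith
  qed
  finally have I: "invertible_elt (1 + ?i)" by (rule invertible_elt_one_plus)
  have ll: "sc lam * sc (1 / lam) = 1"
    using lam by (simp add: sc_1 flip: sc_mult)
  have "(sc lam * U) * (1 + ?i) = sc lam * (U * W) * (sc (1 / lam) * (V * (Q * Q'))) + sc lam * U"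
    by (simp only: distrib_left mult.assoc mult_1_right add.commute)
  also have "\<dots> = (sc lam * sc (1 / lam)) * (V * (Q * Q')) + sc lam * U"
    by (simp only: U_W mult_1_right mult.assoc)
  finally have eq: "(sc lam * U) * (1 + ?i) = V * (Q * Q') + sc lam * U"
    by (simp add: ll)
  have "invertible_elt (sc lam)" unfolding invertible_elt_def using ll sc_comm by metis
  moreover have "invertible_elt U" unfolding invertible_elt_def using U_W W_U by blast
  ultimately have "invertible_elt (V * (Q * Q') + sc lam * U)"
    unfolding eq[symmetric] using I by (intro invertible_elt_mult)
  with straightens_invertible[OF straightens_mult[OF Q(1) Q'(1)] V(1)] show ?thesis .
qed

end

section \<open>Shifts and rotations acting on square summable sequences\<close>

text \<open>Only meaningful for bounded operators, for which \<open>seq_op_of\<close> determines the value.\<close>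

definition op_of :: "((int \<Rightarrow> complex) \<Rightarrow> (int \<Rightarrow> complex)) \<Rightarrow> op" where
  "op_of f = (SOME x. \<forall>u. seq (app x u) = f (seq u))"

lemma seq_op_of:
  assumes "bounded_op f"
  shows "seq (app (op_of f) u) = f (seq u)"
proof -
  let ?g = "\<lambda>u. Ell2 (f (seq u))"
  have s: "seq (?g u) = f (seq u)" for u
    using assms by (simp add: bounded_op_def Ell2_inverse)
  obtain C where C: "\<And>u. u \<in> l2 \<Longrightarrow> l2_norm (f u) \<le> C * l2_norm u"
    using assms unfolding bounded_op_def by blast
  have "\<exists>x. app x = ?g"
  proof (rule op_exists)
    fix u v :: ell2 and r :: real
    have "seq (u + v) = (\<lambda>n. seq u n + seq v n)" by (auto simp: seq_add)
    then have fs: "f (seq (u + v)) = (\<lambda>n. f (seq u) n + f (seq v) n)"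
      using assms by (simp add: bounded_op_def)
    show "?g (u + v) = ?g u + ?g v"
    proof (rule ell2_eqI)
      fix n
      have "seq (?g (u + v)) n = f (seq (u + v)) n" by (simp only: s)
      also have "\<dots> = seq (?g u) n + seq (?g v) n" by (simp only: fs s)
      finally show "seq (?g (u + v)) n = seq (?g u + ?g v) n" by (simp only: seq_add[of "?g u"])
    qed
    have "seq (r *\<^sub>R u) = (\<lambda>n. of_real r * seq u n)" by (auto simp: seq_scaleR)
    then have fs: "f (seq (r *\<^sub>R u)) = (\<lambda>n. of_real r * f (seq u) n)"
      using assms by (simp add: bounded_op_def)
    show "?g (r *\<^sub>R u) = r *\<^sub>R ?g u"
    proof (rule ell2_eqI)
      fix n
      have "seq (?g (r *\<^sub>R u)) n = f (seq (r *\<^sub>R u)) n" by (simp only: s)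
      also have "\<dots> = of_real r * seq (?g u) n" by (simp only: fs s)
      finally show "seq (?g (r *\<^sub>R u)) n = seq (r *\<^sub>R ?g u) n" by (simp only: seq_scaleR[of r "?g u"])
    qed
    show "norm (?g u) \<le> C * norm u" by (simp add: norm_ell2_eq s C)
  qed
  then obtain x where "app x = ?g" by blast
  then have "\<exists>x. \<forall>u. seq (app x u) = f (seq u)" using s by metis
  from someI_ex[OF this] show ?thesis unfolding op_of_def by blast
qed

lemma norm_op_of_le:
  assumes "bounded_op f" "0 \<le> C" "\<And>u. u \<in> l2 \<Longrightarrow> l2_norm (f u) \<le> C * l2_norm u"
  shows "norm (op_of f) \<le> C"
  using assms by (intro norm_op_le) (simp_all add: norm_ell2_eq seq_op_of)

text \<open>The inverse in the operator algebra is a priori only real linear; it is complex homogeneous because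
  it inverts a complex linear map.\<close>

lemma not_in_spectrum_if_invertible:
  assumes f: "bounded_op f" and T: "\<And>u n. f u n = T u n - z * u n"
    and I: "invertible_elt (op_of f)"
  shows "z \<notin> spectrum T"
proof -
  obtain y where y: "op_of f * y = 1" "y * op_of f = 1"
    using I unfolding invertible_elt_def by blast
  define R where "R u = seq (app y (Ell2 u))" for u
  have fT: "(\<lambda>n. T u n - z * u n) = f u" for u by (auto simp: T)
  have fl2: "f u \<in> l2" and fc: "f (\<lambda>n. c * u n) = (\<lambda>n. c * f u n)" if "u \<in> l2" for u c
    using f that unfolding bounded_op_def by auto
  have R: "R u \<in> l2" for u by (simp add: R_def)
  have Rf: "R (f u) = u" if "u \<in> l2" for u
  proof -
    have "f u = seq (app (op_of f) (Ell2 u))" using that by (simp add: seq_op_of[OF f] Ell2_inverse)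
    then have "R (f u) = seq (app (y * op_of f) (Ell2 u))"
      by (simp add: R_def seq_inverse app_mult)
    then show ?thesis using y that by (simp add: app_one Ell2_inverse)
  qed
  have fR: "f (R u) = u" if "u \<in> l2" for u
  proof -
    have "f (R u) = seq (app (op_of f * y) (Ell2 u))"
      by (simp add: R_def seq_op_of[OF f] app_mult)
    then show ?thesis using y that by (simp add: app_one Ell2_inverse)
  qed
  have "bounded_op R"
    unfolding bounded_op_def
  proof (intro conjI ballI allI)
    fix u v assume uv: "u \<in> l2" "v \<in> l2"
    have "Ell2 (\<lambda>n. u n + v n) = Ell2 u + Ell2 v"
      using uv by (intro ell2_eqI) (simp add: seq_add Ell2_inverse l2_add)
    then show "R (\<lambda>n. u n + v n) = (\<lambda>n. R u n + R v n)"
      by (simp add: R_def app_add_right seq_add fun_eq_iff)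
  next
    fix c u assume u: "u \<in> l2"
    have "(\<lambda>n. c * u n) = f (\<lambda>n. c * R u n)" by (simp add: fc R fR u)
    then show "R (\<lambda>n. c * u n) = (\<lambda>n. c * R u n)" by (simp add: Rf l2_cmult R)
  next
    have "l2_norm (R u) \<le> norm y * l2_norm u" if "u \<in> l2" for u
      using norm_app[of y "Ell2 u"] that by (simp add: norm_ell2_eq R_def Ell2_inverse)
    then show "\<exists>C. \<forall>u\<in>l2. l2_norm (R u) \<le> C * l2_norm u" by blast
  qed (rule R)
  then show ?thesis
    unfolding spectrum_def using Rf fR by (auto simp: fT)
qed

lemma l2_norm_shift: "u \<in> l2 \<Longrightarrow> l2_norm (\<lambda>n. u (n + k)) = l2_norm u"
  by (simp add: l2_norm_def l2_shift)

lemma bounded_op_shift: "bounded_op (\<lambda>u n. u (n + k))"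
  unfolding bounded_op_def
  by (auto simp: l2_def l2_shift l2_norm_shift intro!: exI[of _ 1])

lemma bounded_op_multiplication:
  assumes "\<And>n. cmod (m n) \<le> C"
  shows "bounded_op (\<lambda>u n. m n * u n)"
    and "u \<in> l2 \<Longrightarrow> l2_norm (\<lambda>n. m n * u n) \<le> C * l2_norm u"
proof -
  have C: "0 \<le> C" using assms[of 0] norm_ge_zero order_trans by blast
  have "(\<lambda>n. m n * u n) \<in> l2" "l2_norm (\<lambda>n. m n * u n) \<le> C * l2_norm u" if "u \<in> l2" for u
    using l2_le[OF that C, of "\<lambda>n. m n * u n"] assms by (auto simp: norm_mult mult_right_mono)
  then show "bounded_op (\<lambda>u n. m n * u n)"
    and "u \<in> l2 \<Longrightarrow> l2_norm (\<lambda>n. m n * u n) \<le> C * l2_norm u"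
    unfolding bounded_op_def by (auto simp: distrib_left mult.left_commute)
qed

definition scalar :: "complex \<Rightarrow> op" where "scalar c = op_of (\<lambda>u n. c * u n)"
definition shift :: "int \<Rightarrow> op" where "shift k = op_of (\<lambda>u n. u (n + k))"
definition rotation :: "(int \<Rightarrow> real) \<Rightarrow> op" where
  "rotation t = op_of (\<lambda>u n. cis (t n) * u n)"

lemma seq_scalar: "seq (app (scalar c) u) n = c * seq u n"
  unfolding scalar_def
  by (subst seq_op_of) (auto intro: bounded_op_multiplication[where C = "cmod c"])

lemma seq_shift: "seq (app (shift k) u) n = seq u (n + k)"
  unfolding shift_def by (simp add: seq_op_of bounded_op_shift)

lemma seq_rotation: "seq (app (rotation t) u) n = cis (t n) * seq u n"
  unfolding rotation_def
  by (subst seq_op_of) (auto intro: bounded_op_multiplication[where C = 1])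

lemma norm_scalar: "norm (scalar c) \<le> cmod c"
  unfolding scalar_def
  by (rule norm_op_of_le) (auto intro: bounded_op_multiplication[where C = "cmod c"])

lemma norm_shift: "norm (shift k) \<le> 1"
  unfolding shift_def
  by (rule norm_op_of_le) (auto simp: bounded_op_shift l2_norm_shift)

lemma norm_rotation: "norm (rotation t) \<le> 1"
  unfolding rotation_def
  by (rule norm_op_of_le)
    (use bounded_op_multiplication[where C = 1 and m = "\<lambda>n. cis (t n)"] in auto)

lemmas seq_op_simps = app_add app_minus app_mult app_one app_scaleR
  seq_add seq_minus seq_scaleR seq_scalar seq_shift seq_rotation

text \<open>For complex numbers \<open>4 \<bar>a - s b\<bar>\<^sup>2 = (1 + s)\<^sup>2 \<bar>a - b\<bar>\<^sup>2 + (1 - s)\<^sup>2 \<bar>a + b\<bar>\<^sup>2 + (2 - 2 s\<^sup>2) (\<bar>a\<bar>\<^sup>2 - \<bar>b\<bar>\<^sup>2)\<close>.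
  Summed over \<open>a = u n\<close> and \<open>b = c u (n + k)\<close>, the last term vanishes by shift invariance.\<close>

lemma shift_contraction:
  assumes u: "u \<in> l2" and c: "cmod c = 1" and s: "0 \<le> s" "s < 1"
  shows "l2_norm (\<lambda>n. u n - c * u (n + k))
    \<le> 2 / (1 + s) * l2_norm (\<lambda>n. u n - of_real s * c * u (n + k))"
proof -
  let ?A = "\<lambda>n. (cmod (u n))\<^sup>2" and ?B = "\<lambda>n. (cmod (u (n + k)))\<^sup>2"
  let ?D = "\<lambda>n. u n - c * u (n + k)" and ?E = "\<lambda>n. u n - of_real s * c * u (n + k)"
  let ?\<kappa> = "2 - 2 * s\<^sup>2"
  have sA: "?A summable_on UNIV" and sB: "?B summable_on UNIV"
    using u l2_shift(1)[OF u] by (auto simp: l2_def)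
  have uk: "(\<lambda>n. u (n + k)) \<in> l2" using sB by (simp add: l2_def)
  have D: "?D \<in> l2" and E: "?E \<in> l2"
    using l2_minus(1)[OF u l2_cmult(1)[OF uk, of c]]
      l2_minus(1)[OF u l2_cmult(1)[OF uk, of "of_real s * c"]] by (auto simp: mult.assoc)
  have sD: "(\<lambda>n. (cmod (?D n))\<^sup>2) summable_on UNIV" and sE: "(\<lambda>n. (cmod (?E n))\<^sup>2) summable_on UNIV"
    using D E by (auto simp: l2_def)
  have pt: "(1 + s)\<^sup>2 * (cmod (a - b))\<^sup>2 + ?\<kappa> * (cmod a)\<^sup>2
      \<le> 4 * (cmod (a - of_real s * b))\<^sup>2 + ?\<kappa> * (cmod b)\<^sup>2" for a b :: complex
  proof -
    have "4 * (cmod (a - of_real s * b))\<^sup>2 + ?\<kappa> * (cmod b)\<^sup>2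
        = (1 + s)\<^sup>2 * (cmod (a - b))\<^sup>2 + ?\<kappa> * (cmod a)\<^sup>2 + (1 - s)\<^sup>2 * (cmod (a + b))\<^sup>2"
      unfolding cmod_power2 by (simp add: power2_eq_square algebra_simps)
    then show ?thesis by simp
  qed
  have "(1 + s)\<^sup>2 * (\<Sum>\<^sub>\<infinity>n. (cmod (?D n))\<^sup>2) + ?\<kappa> * (\<Sum>\<^sub>\<infinity>n. ?A n)
      = (\<Sum>\<^sub>\<infinity>n. (1 + s)\<^sup>2 * (cmod (?D n))\<^sup>2 + ?\<kappa> * ?A n)"
    by (simp add: infsum_add infsum_cmult_right' summable_on_cmult_right sD sA)
  also have "\<dots> \<le> (\<Sum>\<^sub>\<infinity>n. 4 * (cmod (?E n))\<^sup>2 + ?\<kappa> * ?B n)"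
  proof (rule infsum_mono)
    fix n
    show "(1 + s)\<^sup>2 * (cmod (?D n))\<^sup>2 + ?\<kappa> * ?A n \<le> 4 * (cmod (?E n))\<^sup>2 + ?\<kappa> * ?B n"
      using pt[of "u n" "c * u (n + k)"] c by (simp add: norm_mult mult.assoc)
  qed (intro summable_on_add summable_on_cmult_right sD sE sA sB)+
  also have "\<dots> = 4 * (\<Sum>\<^sub>\<infinity>n. (cmod (?E n))\<^sup>2) + ?\<kappa> * (\<Sum>\<^sub>\<infinity>n. ?B n)"
    by (simp add: infsum_add infsum_cmult_right' summable_on_cmult_right sE sB)
  finally have "(1 + s)\<^sup>2 * (\<Sum>\<^sub>\<infinity>n. (cmod (?D n))\<^sup>2) \<le> 4 * (\<Sum>\<^sub>\<infinity>n. (cmod (?E n))\<^sup>2)"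
    using l2_shift(2)[OF u, of k] by simp
  then have "sqrt ((1 + s)\<^sup>2 * (\<Sum>\<^sub>\<infinity>n. (cmod (?D n))\<^sup>2)) \<le> sqrt (4 * (\<Sum>\<^sub>\<infinity>n. (cmod (?E n))\<^sup>2))"
    by (rule real_sqrt_le_mono)
  then have "(1 + s) * l2_norm ?D \<le> 2 * l2_norm ?E"
    using s by (simp add: l2_norm_def real_sqrt_mult)
  then show ?thesis using s by (simp add: field_simps)
qed

lemma shift_contraction_op:
  assumes "cmod c = 1" "0 \<le> s" "s < 1"
  shows "norm ((1 - scalar c * shift k) * y)
    \<le> 2 / (1 + s) * norm ((1 - s *\<^sub>R (scalar c * shift k)) * y)"
proof (rule norm_op_le)
  fix v
  let ?u = "app y v"
  have "norm (app ((1 - scalar c * shift k) * y) v) = l2_norm (\<lambda>n. seq ?u n - c * seq ?u (n + k))"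
    unfolding norm_ell2_eq by (intro arg_cong[where f = l2_norm] ext) (simp add: seq_op_simps)
  also have "\<dots> \<le> 2 / (1 + s) * l2_norm (\<lambda>n. seq ?u n - of_real s * c * seq ?u (n + k))"
    by (rule shift_contraction) (use assms in auto)
  also have "(\<lambda>n. seq ?u n - of_real s * c * seq ?u (n + k))
      = seq (app ((1 - s *\<^sub>R (scalar c * shift k)) * y) v)"
    by (simp add: fun_eq_iff seq_op_simps)
  also have "2 / (1 + s) * l2_norm \<dots> \<le> 2 / (1 + s) *
      (norm ((1 - s *\<^sub>R (scalar c * shift k)) * y) * norm v)"
    by (intro mult_left_mono) (use assms norm_app in \<open>auto simp: norm_ell2_eq[symmetric]\<close>)
  finally show "norm (app ((1 - scalar c * shift k) * y) v)
      \<le> 2 / (1 + s) * norm ((1 - s *\<^sub>R (scalar c * shift k)) * y) * norm v"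
    by (simp add: mult.assoc)
qed (use assms in auto)

lemma cis_irrational_nonroot:
  assumes "\<alpha> \<notin> \<rat>" "m \<noteq> 0"
  shows "cis (2 * pi * \<alpha>) ^ m \<noteq> 1"
proof
  assume "cis (2 * pi * \<alpha>) ^ m = 1"
  then have "cis (real m * (2 * pi * \<alpha>)) = 1" by (simp only: Complex.DeMoivre)
  then have "cos (real m * (2 * pi * \<alpha>)) = 1" by (simp add: complex_eq_iff)
  then obtain k :: int where "real m * (2 * pi * \<alpha>) = of_int k * 2 * pi"
    using cos_one_2pi_int by blast
  then have "\<alpha> = of_int k / of_int (int m)" using assms(2) by (simp add: field_simps)
  then show False using assms(1) by (metis Rats_divide Rats_of_int)
qed

lemma shift_rotation_pair:
  assumes "\<alpha> \<notin> \<rat>"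
  shows "skew_rotation_pair scalar (shift (- 1)) (shift 1)
    (rotation (\<lambda>n. 2 * pi * (\<omega> + of_int n * \<alpha>))) (cis (2 * pi * \<alpha>))
    (rotation (\<lambda>n. - (2 * pi * (\<omega> + of_int n * \<alpha>))))"
proof
  have inv: "inverse (cis (2 * pi * \<alpha>)) = cis (- (2 * pi * \<alpha>))" by simp
  have alg: "scalar (a + b) = scalar a + scalar b" "scalar (a * b) = scalar a * scalar b"
    "scalar (of_real r) = r *\<^sub>R 1" "scalar a * shift k = shift k * scalar a"
    "scalar a * rotation t = rotation t * scalar a" for a b r k t
    by (intro op_eqI ell2_eqI; simp add: seq_op_simps algebra_simps)+
  show "scalar (a + b) = scalar a + scalar b" "scalar (a * b) = scalar a * scalar b"
    "scalar (of_real r) = r *\<^sub>R 1" for a b r by (rule alg)+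
  show "scalar a * shift (- 1) = shift (- 1) * scalar a" "scalar a * shift 1 = shift 1 * scalar a"
    "scalar a * rotation t = rotation t * scalar a" for a t by (rule alg)+
  show "cis (2 * pi * \<alpha>) ^ m \<noteq> 1" if "m \<noteq> 0" for m
    using cis_irrational_nonroot assms that by blast
  then show "inverse (cis (2 * pi * \<alpha>)) ^ m \<noteq> 1" if "m \<noteq> 0" for m
    using that by (metis inverse_1 inverse_inverse_eq power_inverse)
  let ?U = "rotation (\<lambda>n. 2 * pi * (\<omega> + of_int n * \<alpha>))"
  have c: "cis (2 * pi * \<alpha>) * cis (2 * pi * (\<omega> + of_int (n - 1) * \<alpha>)) = cis (2 * pi * (\<omega> + of_int n * \<alpha>))"
    "cis (- (2 * pi * \<alpha>)) * cis (2 * pi * (\<omega> + of_int (n + 1) * \<alpha>)) = cis (2 * pi * (\<omega> + of_int n * \<alpha>))"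
    for n by (simp_all add: cis_mult algebra_simps)
  show "?U * shift (- 1) = scalar (cis (2 * pi * \<alpha>)) * (shift (- 1) * ?U)"
    by (intro op_eqI ell2_eqI) (simp add: seq_op_simps c(1)[symmetric])
  show "?U * shift 1 = scalar (inverse (cis (2 * pi * \<alpha>))) * (shift 1 * ?U)"
    unfolding inv by (intro op_eqI ell2_eqI) (simp add: seq_op_simps c(2)[symmetric])
  show "shift (- 1) * shift 1 = 1" "shift 1 * shift (- 1) = 1"
    by (intro op_eqI ell2_eqI; simp add: seq_op_simps)+
  show "?U * rotation (\<lambda>n. - (2 * pi * (\<omega> + of_int n * \<alpha>))) = 1"
    "rotation (\<lambda>n. - (2 * pi * (\<omega> + of_int n * \<alpha>))) * ?U = 1"
    by (intro op_eqI ell2_eqI; simp add: seq_op_simps cis_mult flip: mult.assoc)+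
qed (rule norm_scalar norm_shift norm_rotation shift_contraction_op; assumption)+

lemma bounded_op_H_minus: "bounded_op (\<lambda>u n. H g \<alpha> lam \<omega> u n - z * u n)"
proof -
  let ?h = "H g \<alpha> lam \<omega>"
  note h = bounded_op_H[of g \<alpha> lam \<omega>, unfolded bounded_op_def]
  obtain C where C: "\<And>u. u \<in> l2 \<Longrightarrow> l2_norm (?h u) \<le> C * l2_norm u" using h by blast
  have "l2_norm (\<lambda>n. ?h u n - z * u n) \<le> (C + cmod z) * l2_norm u" if u: "u \<in> l2" for u
    using l2_minus(2)[OF _ l2_cmult(1)[OF u], of "?h u" z] C[OF u] h u
    by (auto simp: l2_cmult algebra_simps intro: order_trans)
  then show ?thesis
    using h unfolding bounded_op_def
    by (intro conjI exI[of _ "C + cmod z"]) (auto simp: algebra_simps intro!: l2_minus l2_cmult)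
qed

text \<open>The symbol \<open>e\<^sup>-\<^sup>g w + e\<^sup>g / w - z\<close> vanishes at \<open>\<zeta>\<close> and \<open>\<xi>\<close>. A root outside the unit disc gives a factor
  \<open>1 - w / root\<close>. The root \<open>\<zeta>\<close>, when it lies inside, must instead be written as \<open>1 - \<zeta> / w\<close>, to
  have a factor with small coefficient; this changes the leading constant.\<close>

lemma op_of_H_minus:
  fixes \<alpha> \<omega> :: real
  assumes "\<xi> = exp g * (exp g / \<zeta>)" "\<zeta> \<noteq> 0" "z = exp (- g) * \<zeta> + exp g / \<zeta>"
  defines "U \<equiv> rotation (\<lambda>n. 2 * pi * (\<omega> + of_int n * \<alpha>))"
  shows "op_of (\<lambda>u n. H g \<alpha> lam \<omega> u n - z * u n)
      = (scalar (exp g) * shift 1) * ((1 - scalar (1 / \<xi>) * shift (- 1))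
          * (1 - scalar (1 / \<zeta>) * shift (- 1))) + scalar lam * U" (is ?a)
    and "op_of (\<lambda>u n. H g \<alpha> lam \<omega> u n - z * u n)
      = scalar (- exp g / \<zeta>) * ((1 - scalar (1 / \<xi>) * shift (- 1))
          * (1 - scalar \<zeta> * shift 1)) + scalar lam * U" (is ?b)
proof -
  have e: "exp (- g) = 1 / exp g" by (simp add: exp_minus inverse_eq_divide)
  have h: "seq (app (op_of (\<lambda>u n. H g \<alpha> lam \<omega> u n - z * u n)) u) n
      = H g \<alpha> lam \<omega> (seq u) n - z * seq u n" for u n
    by (simp add: seq_op_of[OF bounded_op_H_minus])
  show ?a
    using assms(2) unfolding U_def
    by (intro op_eqI ell2_eqI)
      (simp add: h seq_op_simps, simp add: H_def assms e field_simps)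
  show ?b
    using assms(2) unfolding U_def
    by (intro op_eqI ell2_eqI)
      (simp add: h seq_op_simps, simp add: H_def assms e field_simps)
qed

section \<open>The resolvent set\<close>

text \<open>By Jensen's formula \<open>exp (Re g) * max 1 (1 / cmod \<zeta>)\<close> is the geometric mean of \<open>\<bar>p - z\<bar>\<close> over the unit
  circle, and \<open>cmod \<zeta> = 1\<close> means that \<open>p - z\<close> vanishes somewhere on it. In the factorisations of
  the operator that mean is the modulus of the leading constant.\<close>

lemma not_in_spectrum:
  fixes \<alpha> \<omega> :: real and g lam \<zeta> :: complex
  assumes irr: "\<alpha> \<notin> \<rat>" and g: "0 \<le> Re g"
    and \<zeta>: "\<zeta> \<noteq> 0" "cmod \<zeta> \<le> exp (Re g)" and z: "z = exp (- g) * \<zeta> + exp g / \<zeta>"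
    and lam: "cmod \<zeta> \<noteq> 1 \<and> cmod lam < exp (Re g) * max 1 (1 / cmod \<zeta>)
      \<or> cmod lam > exp (Re g) * max 1 (1 / cmod \<zeta>)"
  shows "z \<notin> spectrum (H g \<alpha> lam \<omega>)"
proof -
  define \<xi> where "\<xi> = exp g * (exp g / \<zeta>)"
  interpret skew_rotation_pair scalar "shift (- 1)" "shift 1"
    "rotation (\<lambda>n. 2 * pi * (\<omega> + of_int n * \<alpha>))" "cis (2 * pi * \<alpha>)"
    "rotation (\<lambda>n. - (2 * pi * (\<omega> + of_int n * \<alpha>)))"
    by (rule shift_rotation_pair[OF irr])
  have n\<xi>: "cmod \<xi> = exp (Re g) * (exp (Re g) / cmod \<zeta>)"
    by (simp add: \<xi>_def norm_mult norm_divide)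
  have q: "1 \<le> exp (Re g) / cmod \<zeta>" using \<zeta> by (simp add: field_simps)
  have ge: "cmod \<xi> \<ge> exp (Re g)" unfolding n\<xi> using mult_left_mono[OF q, of "exp (Re g)"] by simp
  have e1: "1 \<le> exp (Re g)" using g by simp
  have \<xi>1: "1 \<le> cmod \<xi>" using ge e1 by linarith
  have c: "cmod (1 / \<xi>) \<le> 1" using \<xi>1 by (auto simp: norm_divide divide_le_eq_1)
  show ?thesis
  proof (rule not_in_spectrum_if_invertible[OF bounded_op_H_minus refl], cases "1 \<le> cmod \<zeta>")
    case True
    let ?V = "scalar (exp g) * shift 1" and ?V' = "scalar (exp (- g)) * shift (- 1)"
    have V: "?V \<in> functions_of_S" by (intro fS_mult sc_fS T_fS)
    have nV: "norm ?V \<le> exp (Re g) * 1" "norm ?V' \<le> exp (- Re g) * 1"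
      using norm_scalar[of "exp g"] norm_scalar[of "exp (- g)"]
      by (auto intro!: order_trans[OF norm_mult_ineq] mult_mono norm_shift simp del: mult_1_right)
    have VV: "?V * ?V' = 1" "?V' * ?V = 1"
      by (intro op_eqI ell2_eqI; simp add: seq_op_simps flip: mult.assoc exp_add)+
    have m: "max 1 (1 / cmod \<zeta>) = 1" using True by (simp add: divide_le_eq_1)
    have c': "cmod (1 / \<zeta>) \<le> 1" using True by (simp add: norm_divide divide_le_eq_1)
    show "invertible_elt (op_of (\<lambda>u n. H g \<alpha> lam \<omega> u n - z * u n))"
      unfolding op_of_H_minus(1)[OF \<xi>_def \<zeta>(1) z]
    proof (cases "cmod lam > exp (Re g)")
      case True
      show "invertible_elt (?V * ((1 - scalar (1 / \<xi>) * shift (- 1)) * (1 - scalar (1 / \<zeta>) * shift (- 1)))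
          + scalar lam * rotation (\<lambda>n. 2 * pi * (\<omega> + of_int n * \<alpha>)))"
        by (rule skew_invertible_if_rotation_dominates) (use c c' V nV True in auto)
    next
      case False
      then have l: "cmod \<zeta> \<noteq> 1" "cmod lam < exp (Re g)" using lam m by auto
      then have z1: "1 < cmod \<zeta>" using True by simp
      then have "1 < exp (Re g)" using \<zeta>(2) by linarith
      then have "1 < cmod \<xi>" using ge by linarith
      moreover have "norm ?V' * cmod lam < 1"
      proof -
        have "norm ?V' * cmod lam \<le> exp (- Re g) * cmod lam"
          using nV(2) by (intro mult_right_mono) auto
        also have "\<dots> < exp (- Re g) * exp (Re g)" using l by simp
        finally show ?thesis by (simp flip: exp_add)
      qed
      ultimately show "invertible_elt (?V * ((1 - scalar (1 / \<xi>) * shift (- 1)) * (1 - scalar (1 / \<zeta>) * shift (- 1)))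
          + scalar lam * rotation (\<lambda>n. 2 * pi * (\<omega> + of_int n * \<alpha>)))"
        using z1 by (intro skew_invertible_if_symbol_dominates[OF _ _ _ V VV])
          (auto simp: norm_divide divide_less_eq_1)
    qed
  next
    case False
    let ?k = "- exp g / \<zeta>"
    let ?V = "scalar ?k" and ?V' = "scalar (1 / ?k)"
    have V: "?V \<in> functions_of_S" by (rule sc_fS)
    have nk: "cmod ?k = exp (Re g) / cmod \<zeta>" by (simp add: norm_divide)
    have VV: "?V * ?V' = 1" "?V' * ?V = 1"
      using \<zeta>(1) by (simp_all add: sc_1 flip: sc_mult)
    have m: "exp (Re g) * max 1 (1 / cmod \<zeta>) = cmod ?k"
      unfolding nk using False \<zeta>(1) by (simp add: max_def field_simps)
    have kpos: "0 < cmod ?k" using \<zeta>(1) by simp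
    have "cmod \<zeta> < exp (Re g)" using False e1 by linarith
    then have q1: "1 < exp (Re g) / cmod \<zeta>" using \<zeta>(1) by (simp add: field_simps)
    have "1 * 1 < exp (Re g) * (exp (Re g) / cmod \<zeta>)"
      by (rule mult_le_less_imp_less) (use e1 q1 in auto)
    then have "1 < cmod \<xi>" by (simp add: n\<xi>)
    then have c1: "cmod (1 / \<xi>) < 1" by (simp add: norm_divide divide_less_eq_1)
    show "invertible_elt (op_of (\<lambda>u n. H g \<alpha> lam \<omega> u n - z * u n))"
      unfolding op_of_H_minus(2)[OF \<xi>_def \<zeta>(1) z]
    proof (cases "cmod lam > cmod ?k")
      case True
      have "norm ?V < cmod lam" using norm_scalar[of ?k] True by linarith
      then show "invertible_elt (?V * ((1 - scalar (1 / \<xi>) * shift (- 1)) * (1 - scalar \<zeta> * shift 1))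
          + scalar lam * rotation (\<lambda>n. 2 * pi * (\<omega> + of_int n * \<alpha>)))"
        by (intro skew_invertible_if_rotation_dominates) (use c False V in auto)
    next
      case False': False
      then have l: "cmod lam < cmod ?k" using lam m by auto
      have "norm ?V' * cmod lam \<le> 1 / cmod ?k * cmod lam"
        using norm_scalar[of "1 / ?k"] by (intro mult_right_mono) (simp_all add: norm_divide)
      also have "\<dots> < 1" using l kpos by (simp add: divide_less_eq_1)
      finally show "invertible_elt (?V * ((1 - scalar (1 / \<xi>) * shift (- 1)) * (1 - scalar \<zeta> * shift 1))
          + scalar lam * rotation (\<lambda>n. 2 * pi * (\<omega> + of_int n * \<alpha>)))"
        using c1 False by (intro skew_invertible_if_symbol_dominates[OF _ _ _ V VV]) auto
    qed
  qed
qed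

section \<open>Approximate eigenvectors\<close>

lemma in_spectrum_if_approximate_eigenvectors:
  assumes "\<And>\<epsilon>. 0 < \<epsilon> \<Longrightarrow> \<exists>u\<in>l2. 0 < l2_norm u \<and> (\<lambda>n. T u n - z * u n) \<in> l2
    \<and> l2_norm (\<lambda>n. T u n - z * u n) \<le> \<epsilon> * l2_norm u"
  shows "z \<in> spectrum T"
proof (rule ccontr)
  assume "z \<notin> spectrum T"
  then obtain R where R: "bounded_op R" "\<And>u. u \<in> l2 \<Longrightarrow> R (\<lambda>n. T u n - z * u n) = u"
    unfolding spectrum_def by blast
  then obtain C where C: "\<And>u. u \<in> l2 \<Longrightarrow> l2_norm (R u) \<le> C * l2_norm u"
    unfolding bounded_op_def by blast
  define B where "B = 2 * (\<bar>C\<bar> + 1)"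
  have B: "0 < B" "C \<le> B / 2" by (auto simp: B_def)
  obtain u where u: "u \<in> l2" "0 < l2_norm u" "(\<lambda>n. T u n - z * u n) \<in> l2"
    "l2_norm (\<lambda>n. T u n - z * u n) \<le> 1 / B * l2_norm u"
    using assms[of "1 / B"] B by auto
  have "l2_norm u \<le> C * l2_norm (\<lambda>n. T u n - z * u n)"
    using C[OF u(3)] R(2)[OF u(1)] by simp
  also have "\<dots> \<le> B / 2 * l2_norm (\<lambda>n. T u n - z * u n)"
    by (intro mult_right_mono B l2_norm_nonneg)
  also have "\<dots> \<le> B / 2 * (1 / B * l2_norm u)"
    using u B by (intro mult_left_mono) auto
  also have "\<dots> = l2_norm u / 2" using B by simp
  finally show False using u by simp
qed

lemma periodic_mult:
  fixes h :: "int \<Rightarrow> real"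
  assumes "\<And>n. h (n + p) = h n"
  shows "h (n + i * p) = h n"
proof (induction i arbitrary: n rule: int_induct[where k = 0])
  case (step1 i)
  have "h (n + (i + 1) * p) = h ((n + i * p) + p)" by (simp add: algebra_simps)
  then show ?case using step1 assms by simp
next
  case (step2 i)
  have "h (n + (i - 1) * p) = h ((n + (i - 1) * p) + p)" by (simp only: assms)
  also have "\<dots> = h (n + i * p)" by (simp add: algebra_simps)
  finally show ?case using step2 by simp
qed simp

text \<open>If \<open>cmod v\<close> has period \<open>q\<close>, a window of \<open>K\<close> periods carries at least \<open>K\<close> times the maximal mass
  \<open>M\<^sup>2\<close>, while cutting off creates an error at only four sites, each of size at most \<open>2 exp (Re g) M\<close>.
  The other error is the discrepancy, on the window, between the actual potential and the potential
  \<open>m\<close> of the equation that \<open>v\<close> solves.\<close>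

lemma approximate_eigenvector_by_cutoff:
  fixes v m :: "int \<Rightarrow> complex" and q K :: nat and k :: int
  assumes q: "0 < q" and K: "0 < K" and g: "0 \<le> Re g" and \<delta>: "0 \<le> \<delta>"
    and per: "\<And>n. cmod (v (n + int q)) = cmod (v n)" and nz: "v n0 \<noteq> 0"
    and eq: "\<And>j. exp (- g) * v (j - 1) + exp g * v (j + 1) + m j * v j = z * v j"
    and close: "\<And>j. 0 \<le> j \<Longrightarrow> j < int K * int q \<Longrightarrow>
      cmod (lam * cis (2 * pi * (\<omega> + of_int (k + j) * \<alpha>)) - m j) \<le> \<delta>"
  shows "\<exists>u\<in>l2. 0 < l2_norm u \<and> (\<lambda>n. H g \<alpha> lam \<omega> u n - z * u n) \<in> l2
    \<and> l2_norm (\<lambda>n. H g \<alpha> lam \<omega> u n - z * u n) \<le> (\<delta> + 4 * exp (Re g) / sqrt K) * l2_norm u"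
proof -
  define N where "N = int K * int q"
  have "0 < N" using q K by (simp add: N_def)
  then have N: "1 \<le> N" by simp
  define M where "M = Max ((\<lambda>n. cmod (v n)) ` {0..<int q})"
  have ne: "{0..<int q} \<noteq> {}" using q by simp
  have per': "cmod (v (n + i * int q)) = cmod (v n)" for n i
    using periodic_mult[of "\<lambda>n. cmod (v n)" "int q"] per by simp
  have md: "cmod (v n) = cmod (v (n mod int q))" for n
    using per'[of "n mod int q" "n div int q"] by (simp add: mult.commute)
  have M: "cmod (v n) \<le> M" for n
    unfolding M_def md[of n] by (rule Max_ge) (use q in auto)
  have "M \<in> (\<lambda>n. cmod (v n)) ` {0..<int q}"
    unfolding M_def by (rule Max_in) (use ne in auto)
  then obtain j0 where j0: "0 \<le> j0" "j0 < int q" "cmod (v j0) = M" by auto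
  have Mpos: "0 < M" using M[of n0] nz by (meson less_le_trans zero_less_norm_iff)
  define u where "u n = (if 0 \<le> n - k \<and> n - k < N then v (n - k) else 0)" for n
  define w where "w n = (if 0 \<le> n - k \<and> n - k < N
    then (lam * cis (2 * pi * (\<omega> + of_int n * \<alpha>)) - m (n - k)) * v (n - k) else 0)" for n
  \<comment> \<open>\<open>w\<close> is the error from the potential, \<open>b\<close> the error from the boundary of the window.\<close>
  define b where "b n = H g \<alpha> lam \<omega> u n - z * u n - w n" for n
  have "{n. u n \<noteq> 0} \<subseteq> {k..<k + N}" by (auto simp: u_def)
  then have u2: "u \<in> l2" using l2_finite_support(1) finite_subset by blast
  have "cmod (w n) \<le> \<delta> * cmod (u n)" for n
    using close[of "n - k"] by (auto simp: w_def u_def norm_mult N_def intro!: mult_right_mono)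
  then have w2: "w \<in> l2" "l2_norm w \<le> \<delta> * l2_norm u" by (rule l2_le[OF u2 \<delta>])+
  have bz: "b n = 0" if "n - k \<notin> {- 1, 0, N - 1, N}" for n
  proof (cases "0 \<le> n - k \<and> n - k < N")
    case True
    with that have i: "0 < n - k" "n - k < N - 1" by auto
    have e: "n - 1 - k = n - k - 1" "n + 1 - k = n - k + 1" by auto
    show ?thesis
      using eq[of "n - k"] i by (simp add: b_def H_def w_def u_def e algebra_simps)
  next
    case False
    with that have "n - k < - 1 \<or> N < n - k" by auto
    then show ?thesis by (auto simp: b_def H_def w_def u_def)
  qed
  have bb: "cmod (b n) \<le> 2 * exp (Re g) * M" for n
  proof -
    define s where "s i = (if 0 \<le> n + i - k \<and> n + i - k < N then 1 else 0) - (if 0 \<le> n - k \<and> n - k < N then 1 else (0::complex))" for i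
    have s: "cmod (s i) \<le> 1" for i by (auto simp: s_def)
    have e: "n - 1 - k = n - k - 1" "n + 1 - k = n - k + 1" by auto
    have "b n = exp (- g) * (s (- 1) * v (n - k - 1)) + exp g * (s 1 * v (n - k + 1))"
      using eq[of "n - k"] by (simp add: b_def H_def w_def u_def s_def e algebra_simps)
    also have "cmod \<dots> \<le> exp (- Re g) * (1 * M) + exp (Re g) * (1 * M)"
      by (rule norm_triangle_mono; unfold norm_mult; intro mult_mono M s) (use Mpos in auto)
    also have "exp (- Re g) \<le> exp (Re g)" using g by simp
    finally show ?thesis using Mpos by (simp add: algebra_simps)
  qed
  have bf: "{n. b n \<noteq> 0} \<subseteq> {k - 1, k, k + N - 1, k + N}" using bz by force
  then have fin: "finite {n. b n \<noteq> 0}" using finite_subset by blast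
  have b2: "b \<in> l2" using l2_finite_support(1)[OF fin] .
  have "(l2_norm b)\<^sup>2 = (\<Sum>n | b n \<noteq> 0. (cmod (b n))\<^sup>2)" by (rule l2_finite_support(2)[OF fin])
  also have "\<dots> \<le> (\<Sum>n | b n \<noteq> 0. (2 * exp (Re g) * M)\<^sup>2)"
    by (intro sum_mono power_mono bb) auto
  also have "\<dots> = real (card {n. b n \<noteq> 0}) * (2 * exp (Re g) * M)\<^sup>2" by simp
  also have "\<dots> \<le> 4 * (2 * exp (Re g) * M)\<^sup>2"
  proof (rule mult_right_mono)
    have "card {n. b n \<noteq> 0} \<le> card {k - 1, k, k + N - 1, k + N}"
      by (rule card_mono[OF _ bf]) simp
    also have "\<dots> \<le> 4" by (simp add: card_insert_if)
    finally show "real (card {n. b n \<noteq> 0}) \<le> 4" by simp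
  qed simp
  also have "\<dots> = (4 * exp (Re g) * M)\<^sup>2" by (simp add: power_mult_distrib)
  finally have bn: "l2_norm b \<le> 4 * exp (Re g) * M"
    by (rule power2_le_imp_le) (use Mpos in simp)
  have un: "sqrt K * M \<le> l2_norm u"
  proof -
    let ?f = "\<lambda>i::nat. k + j0 + int i * int q"
    have inj: "inj_on ?f {..<K}" using q by (auto simp: inj_on_def)
    have uf: "cmod (u (?f i)) = M" if "i < K" for i
    proof -
      have "int i * int q + int q \<le> N"
      proof -
        have "(int i + 1) * int q \<le> int K * int q" by (rule mult_right_mono) (use that in auto)
        then show ?thesis by (simp add: N_def algebra_simps)
      qed
      then have "u (?f i) = v (j0 + int i * int q)" using j0 by (auto simp: u_def)
      then show ?thesis by (simp add: per' j0)
    qed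
    have "L2_set (\<lambda>n. cmod (u n)) (?f ` {..<K}) = sqrt (\<Sum>i<K. (cmod (u (?f i)))\<^sup>2)"
      unfolding L2_set_def by (simp add: sum.reindex[OF inj])
    also have "\<dots> = sqrt (\<Sum>i<K. M\<^sup>2)" by (simp add: uf)
    also have "\<dots> = sqrt K * M" using Mpos by (simp add: real_sqrt_mult)
    finally show ?thesis using l2_L2_set_le[OF u2, of "?f ` {..<K}"] by simp
  qed
  have Hu: "(\<lambda>n. H g \<alpha> lam \<omega> u n - z * u n) = (\<lambda>n. w n + b n)" by (simp add: b_def)
  have "l2_norm (\<lambda>n. w n + b n) \<le> \<delta> * l2_norm u + 4 * exp (Re g) * M"
    using l2_add(2)[OF w2(1) b2] w2(2) bn by linarith
  also have "4 * exp (Re g) * M \<le> 4 * exp (Re g) / sqrt K * l2_norm u"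
    using un K by (simp add: field_simps)
  finally have "l2_norm (\<lambda>n. w n + b n) \<le> (\<delta> + 4 * exp (Re g) / sqrt K) * l2_norm u"
    by (simp add: algebra_simps)
  moreover have "0 < l2_norm u"
    using un Mpos K by (metis less_le_trans mult_pos_pos of_nat_0_less_iff real_sqrt_gt_zero)
  ultimately show ?thesis
    using u2 l2_add(1)[OF w2(1) b2] unfolding Hu[symmetric] by blast
qed

section \<open>Bloch waves for rational rotation numbers\<close>

lemma cis_int_period: "cis (x + 2 * pi * of_int k) = cis x" "cis (x - 2 * pi * of_int k) = cis x"
proof -
  have "cis (2 * pi * of_int k) = 1"
    by (simp add: cis_multiple_2pi)
  then show "cis (x + 2 * pi * of_int k) = cis x" "cis (x - 2 * pi * of_int k) = cis x"
    by (simp_all flip: cis_mult cis_divide)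
qed

lemma cis_rational_nonroot:
  fixes a :: int and q j :: nat
  assumes "coprime a (int q)" "0 < j" "j < q"
  shows "cis (2 * pi * of_nat j * of_int a / of_nat q) \<noteq> 1"
proof
  let ?x = "2 * pi * of_nat j * of_int a / of_nat q"
  assume "cis ?x = 1"
  then have "cos ?x = 1" by (simp add: complex_eq_iff)
  then obtain i :: int where "?x = of_int i * 2 * pi" using cos_one_2pi_int by blast
  then have "real_of_int (int j * a) = real_of_int (i * int q)"
    using assms by (simp add: field_simps)
  then have "int j * a = i * int q" by linarith
  then have "int q dvd int j * a" by simp
  then have "int q dvd int j" using assms(1) by (simp add: coprime_commute coprime_dvd_mult_left_iff)
  then show False using assms by (auto dest: zdvd_imp_le)
qed

text \<open>For rotation number \<open>a / q\<close> the plane waves with frequencies \<open>x j\<close> span an invariant space: the shifts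
  act on them diagonally and the potential permutes them cyclically. The eigenvalue equation is
  therefore a recursion \<open>\<mu> f (j + 1) = - p j f j\<close> for the coefficients, and it closes up after \<open>q\<close>
  steps exactly when the product condition \<open>P\<close> holds. Coprimality makes the frequencies distinct,
  hence the wave nonzero.\<close>

lemma bloch_wave:
  fixes a :: int and q :: nat and t :: real
  defines "x j \<equiv> t + 2 * pi * of_nat j * of_int a / of_nat q"
  assumes q: "0 < q" and a: "coprime a (int q)" and \<mu>: "\<mu> \<noteq> 0"
    and P: "(\<Prod>j<q. - (exp (- g) * cis (x j) + exp g * cis (- x j) - z)) = \<mu> ^ q"
  obtains v :: "int \<Rightarrow> complex" where
    "\<And>n. cmod (v (n + int q)) = cmod (v n)" "\<exists>n. v n \<noteq> 0"
    "\<And>n. exp (- g) * v (n - 1) + exp g * v (n + 1)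
        + \<mu> * cis (2 * pi * of_int n * of_int a / of_nat q) * v n = z * v n"
proof -
  define p where "p j = exp (- g) * cis (x j) + exp g * cis (- x j) - z" for j
  define f where "f j = (\<Prod>i<j. - p i / \<mu>)" for j
  define v where "v n = (\<Sum>j<q. f j * cis (- (of_int n * x j)))" for n :: int
  have f0: "f 0 = 1" by (simp add: f_def)
  have fS: "\<mu> * f (Suc j) = - p j * f j" for j using \<mu> by (simp add: f_def)
  have fq: "f q = 1"
    using P \<mu> by (simp add: f_def p_def prod_dividef)
  have vper: "v (n + int q) = cis (- (of_nat q * t)) * v n" for n
  proof -
    have "cis (- (of_int (n + int q) * x j)) = cis (- (of_nat q * t)) * cis (- (of_int n * x j))" for j
    proof -
      have "- (of_int (n + int q) * x j) = - (of_nat q * t) + - (of_int n * x j) - 2 * pi * of_int (int j * a)"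
        using q by (simp add: x_def field_simps)
      then show ?thesis by (simp only: cis_int_period cis_mult)
    qed
    then show ?thesis unfolding v_def by (simp add: sum_distrib_left mult_ac)
  qed
  have eq: "exp (- g) * v (n - 1) + exp g * v (n + 1)
        + \<mu> * cis (2 * pi * of_int n * of_int a / of_nat q) * v n = z * v n" for n
  proof -
    \<comment> \<open>The terms of \<open>v n\<close> after multiplication by the potential, which lowers the frequency by one step.\<close>
    define E where "E j = f j * cis (- (of_int n * (x j - 2 * pi * of_int a / of_nat q)))" for j
    have E0: "E q = E 0"
    proof -
      have "- (of_int n * (x q - 2 * pi * of_int a / of_nat q))
          = - (of_int n * (x 0 - 2 * pi * of_int a / of_nat q)) - 2 * pi * of_int (n * a)"
        using q by (simp add: x_def field_simps)
      then show ?thesis unfolding E_def fq f0 by (simp only: cis_int_period)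
    qed
    have ES: "E (Suc j) = f (Suc j) * cis (- (of_int n * x j))" for j
    proof -
      have "x (Suc j) - 2 * pi * of_int a / of_nat q = x j" using q by (simp add: x_def field_simps)
      then show ?thesis by (simp add: E_def)
    qed
    have "(\<Sum>j<Suc q. E j) = E 0 + (\<Sum>j<q. E (Suc j))" by (rule sum.lessThan_Suc_shift)
    then have sE: "(\<Sum>j<q. E j) = (\<Sum>j<q. E (Suc j))" using E0 by simp
    have "\<mu> * cis (2 * pi * of_int n * of_int a / of_nat q) * v n = \<mu> * (\<Sum>j<q. E j)"
      unfolding v_def sum_distrib_left E_def
      by (intro sum.cong refl) (simp add: cis_mult algebra_simps)
    also have "\<dots> = (\<Sum>j<q. - p j * f j * cis (- (of_int n * x j)))"
      unfolding sE sum_distrib_left ES fS[symmetric] by (simp add: mult.assoc)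
    finally have 1: "\<mu> * cis (2 * pi * of_int n * of_int a / of_nat q) * v n
        = (\<Sum>j<q. - p j * f j * cis (- (of_int n * x j)))" .
    have sh: "cis (- (of_int (n - 1) * x j)) = cis (x j) * cis (- (of_int n * x j))"
      "cis (- (of_int (n + 1) * x j)) = cis (- x j) * cis (- (of_int n * x j))" for j
      by (simp_all add: cis_mult algebra_simps)
    have "exp (- g) * v (n - 1) + exp g * v (n + 1) - z * v n
        = (\<Sum>j<q. p j * f j * cis (- (of_int n * x j)))"
      unfolding v_def sh sum_distrib_left sum.distrib[symmetric] sum_subtractf[symmetric]
      by (intro sum.cong refl) (simp add: p_def algebra_simps)
    with 1 show ?thesis by (simp add: sum_negf algebra_simps)
  qed
  have "\<exists>n. v n \<noteq> 0"
  proof (rule ccontr)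
    assume "\<not> (\<exists>n. v n \<noteq> 0)"
    \<comment> \<open>Discrete Fourier inversion recovers the coefficient \<open>f 0 = 1\<close>.\<close>
    then have "0 = (\<Sum>n<q. cis (of_nat n * t) * v (int n))" by simp
    also have "\<dots> = (\<Sum>n<q. \<Sum>j<q. f j * cis (- (2 * pi * of_nat j * of_int a / of_nat q)) ^ n)"
    proof (intro sum.cong refl)
      fix n
      have "cis (of_nat n * t) * cis (- (of_int (int n) * x j))
          = cis (- (2 * pi * of_nat j * of_int a / of_nat q)) ^ n" for j
        unfolding Complex.DeMoivre cis_mult by (simp add: x_def algebra_simps)
      then show "cis (of_nat n * t) * v (int n)
          = (\<Sum>j<q. f j * cis (- (2 * pi * of_nat j * of_int a / of_nat q)) ^ n)"
        unfolding v_def sum_distrib_left by (intro sum.cong refl) (simp add: mult_ac)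
    qed
    also have "\<dots> = (\<Sum>j<q. f j * (\<Sum>n<q. cis (- (2 * pi * of_nat j * of_int a / of_nat q)) ^ n))"
      by (subst sum.swap) (simp add: sum_distrib_left)
    also have "\<dots> = (\<Sum>j<q. if j = 0 then of_nat q else 0)"
    proof (intro sum.cong refl)
      fix j assume "j \<in> {..<q}"
      show "f j * (\<Sum>n<q. cis (- (2 * pi * of_nat j * of_int a / of_nat q)) ^ n)
          = (if j = 0 then of_nat q else 0)"
      proof (cases "j = 0")
        case False
        let ?c = "cis (- (2 * pi * of_nat j * of_int a / of_nat q))"
        have "inverse ?c \<noteq> 1"
          using cis_rational_nonroot[OF a, of j] False \<open>j \<in> {..<q}\<close> by simp
        then have "?c \<noteq> 1" by (metis inverse_1)
        moreover have "?c ^ q = 1"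
        proof -
          have "?c ^ q = cis (0 - 2 * pi * of_int (int j * a))"
            unfolding Complex.DeMoivre using q by (simp add: field_simps)
          then show ?thesis by (simp only: cis_int_period cis_zero)
        qed
        ultimately have "(\<Sum>n<q. ?c ^ n) = 0" by (simp add: geometric_sum)
        with False show ?thesis by simp
      qed (simp add: f0)
    qed
    also have "\<dots> = of_nat q" using q by (simp add: sum.delta)
    finally show False using q by simp
  qed
  moreover have "cmod (v (n + int q)) = cmod (v n)" for n by (simp add: vper norm_mult)
  ultimately show ?thesis using that eq by blast
qed

text \<open>The identity \<open>(\<Prod>j<q. y - c j) = y ^ q - 1\<close> for the \<open>q\<close>-th roots of unity \<open>c j\<close>, evaluated at
  \<open>y = \<zeta> / cis t\<close>.\<close>

lemma prod_roots_of_unity: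
  fixes a :: int and q :: nat and t :: real and \<zeta> :: complex
  assumes q: "0 < q" and a: "coprime a (int q)"
  shows "cmod (\<Prod>j<q. cis (t + 2 * pi * of_nat j * of_int a / of_nat q) - \<zeta>)
    = cmod (cis (of_nat q * t) - \<zeta> ^ q)"
proof -
  define c where "c j = cis (2 * pi * of_nat j * of_int a / of_nat q)" for j :: nat
  have inj: "inj_on c {..<q}"
  proof (rule linorder_inj_onI')
    fix i j assume ij: "i \<in> {..<q}" "j \<in> {..<q}" "i < j"
    have "c j = c i * cis (2 * pi * of_nat (j - i) * of_int a / of_nat q)"
      using ij(3) by (simp add: c_def cis_mult of_nat_diff add_divide_distrib[symmetric] algebra_simps)
    moreover have "cis (2 * pi * of_nat (j - i) * of_int a / of_nat q) \<noteq> 1"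
      by (rule cis_rational_nonroot[OF a]) (use ij in auto)
    ultimately show "c i \<noteq> c j" by (simp add: c_def)
  qed
  have cq: "c j ^ q = 1" for j
  proof -
    have "c j ^ q = cis (0 + 2 * pi * of_int (int j * a))"
      unfolding c_def Complex.DeMoivre using q by (simp add: field_simps)
    then show ?thesis by (simp only: cis_int_period cis_zero)
  qed
  have eqp: "(\<Prod>j<q. [:- c j, 1:]) = monom 1 q - 1"
  proof (rule poly_eqI_degree_lead_coeff)
    show "degree (\<Prod>j<q. [:- c j, 1:]) \<le> q"
      using degree_prod_sum_le[of "{..<q}" "\<lambda>j. [:- c j, 1:]"] by simp
    show "degree (monom 1 q - 1 :: complex poly) \<le> q"
      by (intro degree_diff_le) (auto simp: degree_monom_le)
    show "coeff (\<Prod>j<q. [:- c j, 1:]) q = coeff (monom 1 q - 1) q"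
    proof -
      have "degree (\<Prod>j<q. [:- c j, 1:]) = q" by (subst degree_prod_eq_sum_degree) auto
      then have "coeff (\<Prod>j<q. [:- c j, 1:]) q = lead_coeff (\<Prod>j<q. [:- c j, 1:])" by simp
      also have "\<dots> = 1" by (simp add: lead_coeff_prod)
      finally show ?thesis using q by (simp add: coeff_eq_0)
    qed
    show "q \<le> card (c ` {..<q})" by (simp add: card_image[OF inj])
    show "poly (\<Prod>j<q. [:- c j, 1:]) w = poly (monom 1 q - 1) w" if "w \<in> c ` {..<q}" for w
      using that cq by (auto simp: poly_prod poly_monom)
  qed
  have pe: "(\<Prod>j<q. y - c j) = y ^ q - 1" for y
    using arg_cong[OF eqp, of "\<lambda>p. poly p y"] by (simp add: poly_prod poly_monom)
  define b where "b = - cis t"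
  have "cis (t + 2 * pi * of_nat j * of_int a / of_nat q) - \<zeta> = b * (\<zeta> * cis (- t) - c j)" for j
    by (simp add: b_def c_def cis_mult algebra_simps)
  then have "(\<Prod>j<q. cis (t + 2 * pi * of_nat j * of_int a / of_nat q) - \<zeta>)
      = b ^ q * ((\<zeta> * cis (- t)) ^ q - 1)"
    by (simp add: prod.distrib pe)
  also have "b ^ q = (- 1) ^ q * cis t ^ q" unfolding b_def by (rule power_minus)
  also have "(- 1) ^ q * cis t ^ q * ((\<zeta> * cis (- t)) ^ q - 1)
      = (- 1) ^ q * (\<zeta> ^ q * (cis t * cis (- t)) ^ q - cis t ^ q)"
    by (simp add: power_mult_distrib algebra_simps)
  also have "\<dots> = (- 1) ^ q * (\<zeta> ^ q - cis (of_nat q * t))"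
    by (simp add: cis_mult Complex.DeMoivre)
  finally show ?thesis by (simp add: norm_mult norm_power norm_minus_commute)
qed

section \<open>Resonances and points of the spectrum\<close>

lemma cmod_cis_diff_le: "cmod (cis x - cis y) \<le> \<bar>x - y\<bar>"
proof -
  have "cis x - cis y = cis y * (cis (x - y) - 1)" by (simp add: cis_mult algebra_simps)
  then have "cmod (cis x - cis y) = cmod (cis (x - y) - 1)" by (simp add: norm_mult)
  also have "\<dots> = 2 * \<bar>sin ((x - y) / 2)\<bar>"
    using dist_exp_i_1[of "x - y"] by (simp add: cis_conv_exp)
  also have "\<dots> \<le> 2 * \<bar>(x - y) / 2\<bar>" by (intro mult_left_mono abs_sin_x_le_abs_x) auto
  finally show ?thesis by simp
qed

text \<open>The hypothesis asks that, for large denominators \<open>q\<close>, the product of \<open>p - z\<close> over some orbit of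
  length \<open>q\<close> has modulus \<open>r ^ q\<close> with \<open>r\<close> close to \<open>cmod lam\<close>. Then a Bloch wave exists for a rational
  approximation \<open>a / q\<close> of \<open>\<alpha>\<close>, for coupling \<open>r\<close> and some phase. Since the multiples of \<open>\<alpha>\<close> are dense
  modulo 1, the true potential shows this phase on suitable windows; and since
  \<open>\<bar>\<alpha> - a / q\<bar> < 1 / q\<^sup>2\<close>, the two potentials drift apart by only \<open>O(K / q)\<close> over \<open>K\<close> periods.\<close>

lemma in_spectrum_if_resonant:
  fixes \<alpha> \<omega> :: real and g lam \<zeta> :: complex
  assumes irr: "\<alpha> \<notin> \<rat>" and g: "0 \<le> Re g"
    and \<zeta>: "\<zeta> \<noteq> 0" and z: "z = exp (- g) * \<zeta> + exp g / \<zeta>"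
    and res: "\<And>\<epsilon>. 0 < \<epsilon> \<Longrightarrow> \<exists>Q::nat. \<forall>q\<ge>Q. \<exists>t r. 0 < r \<and> \<bar>r - cmod lam\<bar> \<le> \<epsilon> \<and>
      cmod (cis t - \<zeta> ^ q) * cmod (cis t - (exp g * exp g / \<zeta>) ^ q) = (r * exp (Re g)) ^ q"
  shows "z \<in> spectrum (H g \<alpha> lam \<omega>)"
proof (rule in_spectrum_if_approximate_eigenvectors)
  fix \<epsilon> :: real assume \<epsilon>: "0 < \<epsilon>"
  define \<xi> where "\<xi> = exp g * exp g / \<zeta>"
  define L where "L = cmod lam"
  have L: "0 \<le> L" by (simp add: L_def)
  define K where "K = nat \<lceil>(8 * exp (Re g) / \<epsilon>)\<^sup>2\<rceil> + 1"
  have K: "0 < K" by (simp add: K_def)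
  have "(8 * exp (Re g) / \<epsilon>)\<^sup>2 \<le> real K" unfolding K_def by linarith
  then have "8 * exp (Re g) / \<epsilon> \<le> sqrt (real K)" by (rule real_le_rsqrt)
  then have eK: "4 * exp (Re g) / sqrt (real K) \<le> \<epsilon> / 2"
    using \<epsilon> K by (simp add: field_simps)
  \<comment> \<open>\<open>\<eta>\<close> bounds the errors in coupling, phase and rotation number; \<open>D\<close> collects their weights.\<close>
  define D where "D = 1 + 4 * pi * (L + 1)"
  define \<eta> where "\<eta> = \<epsilon> / (2 * D)"
  have den: "0 < D" using L by (simp add: D_def add_pos_nonneg)
  have \<eta>: "0 < \<eta>" "\<eta> * D = \<epsilon> / 2"
    using \<epsilon> den by (simp_all add: \<eta>_def)
  obtain Q :: nat where Q: "\<And>q. Q \<le> q \<Longrightarrow> \<exists>t r. 0 < r \<and> \<bar>r - cmod lam\<bar> \<le> \<eta> \<and>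
      cmod (cis t - \<zeta> ^ q) * cmod (cis t - \<xi> ^ q) = (r * exp (Re g)) ^ q"
    using res[OF \<eta>(1)] unfolding \<xi>_def by blast
  have "infinite (approx_set \<alpha>)" using irr rational_iff_finite_approx_set by blast
  then obtain a k' where ak: "(a, k') \<in> approx_set \<alpha>" "k' > int Q + \<lceil>real K / \<eta>\<rceil>"
    using infinite_approx_set by blast
  define q where "q = nat k'"
  have k'pos: "0 < k'" and cop: "coprime a k'" and ap: "\<bar>\<alpha> - of_int a / of_int k'\<bar> < 1 / (of_int k')\<^sup>2"
    using ak(1) by (auto simp: approx_set_def)
  have qk: "int q = k'" using k'pos by (simp add: q_def)
  have q: "0 < q" "coprime a (int q)" using k'pos cop qk by auto
  have "0 \<le> real K / \<eta>" using \<eta> by simp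
  then have qQ: "Q \<le> q" and qK': "real K / \<eta> \<le> real q"
    using ak(2) qk by linarith+
  have qK: "real K / real q \<le> \<eta>" using qK' \<eta>(1) q by (simp add: field_simps)
  have apq: "\<bar>\<alpha> - of_int a / real q\<bar> \<le> 1 / (real q)\<^sup>2" using ap qk by (metis less_imp_le of_int_of_nat_eq)
  obtain t' r where r: "0 < r" "\<bar>r - L\<bar> \<le> \<eta>"
    "cmod (cis t' - \<zeta> ^ q) * cmod (cis t' - \<xi> ^ q) = (r * exp (Re g)) ^ q"
    using Q[OF qQ] unfolding L_def by blast
  define t where "t = t' / real q"
  have t: "real q * t = t'" using q by (simp add: t_def)
  define x where "x j = t + 2 * pi * of_nat j * of_int a / of_nat q" for j
  define P where "P = (\<Prod>j<q. - (exp (- g) * cis (x j) + exp g * cis (- x j) - z))"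
  have fac: "- (exp (- g) * cis y + exp g * cis (- y) - z)
      = (- exp (- g) * cis (- y)) * (cis y - \<zeta>) * (cis y - \<xi>)" for y
  proof -
    have c: "cis (- y) * cis y = 1" by (simp add: cis_mult)
    have e: "exp (- g) * exp g = 1" by (simp flip: exp_add)
    have s: "exp (- g) * (\<zeta> + \<xi>) = z"
      using \<zeta> e unfolding \<xi>_def z by (simp add: algebra_simps flip: mult.assoc)
    have p: "exp (- g) * (\<zeta> * \<xi>) = exp g"
      using \<zeta> e by (simp add: \<xi>_def flip: mult.assoc)
    have "(- a * C) * (E - \<zeta>) * (E - \<xi>)
        = - ((C * E) * (a * E) - (C * E) * (a * (\<zeta> + \<xi>)) + a * (\<zeta> * \<xi>) * C)" for a C E
      by (simp add: algebra_simps)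
    from this[of "exp (- g)" "cis (- y)" "cis y"]
    show ?thesis unfolding c s p by simp
  qed
  have "cmod P = cmod (\<Prod>j<q. - exp (- g) * cis (- x j))
      * cmod (\<Prod>j<q. cis (x j) - \<zeta>) * cmod (\<Prod>j<q. cis (x j) - \<xi>)"
    unfolding P_def fac prod.distrib norm_mult ..
  also have "\<dots> = exp (- Re g) ^ q * (cmod (cis t' - \<zeta> ^ q) * cmod (cis t' - \<xi> ^ q))"
    using prod_roots_of_unity[OF q, of t] unfolding x_def[symmetric] t
    by (simp add: norm_mult norm_power mult.assoc flip: prod_norm)
  also have "\<dots> = (exp (- Re g) * exp (Re g)) ^ q * r ^ q"
    unfolding r(3) by (simp add: power_mult_distrib)
  finally have cP: "cmod P = r ^ q" by (simp flip: exp_add)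
  define \<phi> where "\<phi> = Arg P / real q"
  define \<mu> where "\<mu> = complex_of_real r * cis \<phi>"
  have "P \<noteq> 0" using cP r(1) by (metis norm_zero power_not_zero less_irrefl)
  have "\<mu> ^ q = of_real (r ^ q) * cis (Arg P)"
    unfolding \<mu>_def power_mult_distrib Complex.DeMoivre \<phi>_def using q by simp
  also have "\<dots> = P"
    using \<open>P \<noteq> 0\<close> by (metis cP cis_Arg rcis_cmod_Arg rcis_def)
  finally have \<mu>q: "P = \<mu> ^ q" by simp
  have \<mu>0: "\<mu> \<noteq> 0" using r by (simp add: \<mu>_def)
  obtain v where v: "\<And>n. cmod (v (n + int q)) = cmod (v n)" "\<exists>n. v n \<noteq> 0"
    "\<And>n. exp (- g) * v (n - 1) + exp g * v (n + 1)
        + \<mu> * cis (2 * pi * of_int n * of_int a / of_nat q) * v n = z * v n"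
    using bloch_wave[OF q \<mu>0 \<mu>q[unfolded P_def x_def]] by blast
  obtain n0 where n0: "v n0 \<noteq> 0" using v(2) by blast
  obtain h k :: int where hk: "\<bar>of_int k * \<alpha> - of_int h - (\<phi> - Arg lam - 2 * pi * \<omega>) / (2 * pi)\<bar> < \<eta>"
    using sequence_of_fractional_parts_is_dense[OF irr \<eta>(1)] by metis
  have close: "cmod (lam * cis (2 * pi * (\<omega> + of_int (k + j) * \<alpha>))
      - \<mu> * cis (2 * pi * of_int j * of_int a / of_nat q)) \<le> \<epsilon> / 2"
    if j: "0 \<le> j" "j < int K * int q" for j
  proof -
    define A where "A = Arg lam + 2 * pi * (\<omega> + of_int (k + j) * \<alpha>) - 2 * pi * of_int h"
    define B where "B = \<phi> + 2 * pi * of_int j * of_int a / of_nat q"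
    have "lam = of_real L * cis (Arg lam)"
      unfolding L_def by (metis rcis_cmod_Arg rcis_def)
    then have "lam * cis (2 * pi * (\<omega> + of_int (k + j) * \<alpha>))
        = of_real L * cis (Arg lam + 2 * pi * (\<omega> + of_int (k + j) * \<alpha>))"
      by (metis cis_mult mult.assoc)
    also have "\<dots> = of_real L * cis A" unfolding A_def cis_int_period ..
    finally have 1: "lam * cis (2 * pi * (\<omega> + of_int (k + j) * \<alpha>)) = of_real L * cis A" .
    have 2: "\<mu> * cis (2 * pi * of_int j * of_int a / of_nat q) = of_real r * cis B"
      by (simp add: \<mu>_def B_def cis_mult mult.assoc)
    have "of_int j * \<bar>\<alpha> - of_int a / real q\<bar> \<le> (real K * real q) * (1 / (real q)\<^sup>2)"
    proof (rule mult_mono[OF _ apq])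
      show "real_of_int j \<le> real K * real q"
        using j(2) by (metis less_imp_le of_int_le_iff of_int_mult of_int_of_nat_eq)
    qed auto
    also have "\<dots> = real K / real q" using q by (simp add: power2_eq_square)
    finally have j2: "\<bar>of_int j * (\<alpha> - of_int a / real q)\<bar> \<le> \<eta>"
      using qK j(1) by (simp add: abs_mult)
    have "A - B = 2 * pi * (of_int k * \<alpha> - of_int h - (\<phi> - Arg lam - 2 * pi * \<omega>) / (2 * pi)
        + of_int j * (\<alpha> - of_int a / real q))"
      using q by (simp add: A_def B_def field_simps)
    also have "\<bar>\<dots>\<bar> \<le> 2 * pi * (\<eta> + \<eta>)"
      unfolding abs_mult
      by (intro mult_mono order_trans[OF abs_triangle_ineq add_mono] less_imp_le[OF hk] j2)
        (use \<eta>(1) in auto)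
    also have "2 * pi * (\<eta> + \<eta>) = 4 * pi * \<eta>" by simp
    finally have "cmod (cis A - cis B) \<le> 4 * pi * \<eta>"
      using cmod_cis_diff_le[of A B] by (rule order_trans[rotated])
    then have "L * cmod (cis A - cis B) \<le> (L + 1) * (4 * pi * \<eta>)"
      using L by (intro mult_mono) auto
    moreover have "of_real L * cis A - of_real r * cis B
        = of_real L * (cis A - cis B) + of_real (L - r) * cis B"
      by (simp add: algebra_simps)
    then have "cmod (of_real L * cis A - of_real r * cis B) \<le> L * cmod (cis A - cis B) + \<bar>L - r\<bar>"
      using norm_triangle_ineq[of "of_real L * (cis A - cis B)" "of_real (L - r) * cis B"] L
      by (simp only: norm_mult norm_of_real norm_cis mult_1_right abs_of_nonneg)
    ultimately have "cmod (of_real L * cis A - of_real r * cis B) \<le> \<eta> * D"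
      using r(2) by (simp add: D_def algebra_simps)
    then show ?thesis unfolding 1 2 \<eta>(2) .
  qed
  obtain u where u: "u \<in> l2" "0 < l2_norm u" "(\<lambda>n. H g \<alpha> lam \<omega> u n - z * u n) \<in> l2"
    "l2_norm (\<lambda>n. H g \<alpha> lam \<omega> u n - z * u n) \<le> (\<epsilon> / 2 + 4 * exp (Re g) / sqrt K) * l2_norm u"
    using approximate_eigenvector_by_cutoff[where v = v and m = "\<lambda>j. \<mu> * cis (2 * pi * of_int j * of_int a / of_nat q)",
        OF q(1) K g _ v(1) n0 v(3) close] \<epsilon> by auto
  have "(\<epsilon> / 2 + 4 * exp (Re g) / sqrt K) * l2_norm u \<le> \<epsilon> * l2_norm u"
    using eK u(2) by (intro mult_right_mono) auto
  then show "\<exists>u\<in>l2. 0 < l2_norm u \<and> (\<lambda>n. H g \<alpha> lam \<omega> u n - z * u n) \<in> l2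
      \<and> l2_norm (\<lambda>n. H g \<alpha> lam \<omega> u n - z * u n) \<le> \<epsilon> * l2_norm u"
    using u by (meson order_trans)
qed

text \<open>A constant factor in the product disappears in the limit, because its \<open>q\<close>-th root tends to \<open>1\<close>.\<close>

lemma resonance_by_bounds:
  fixes G :: "nat \<Rightarrow> real \<Rightarrow> real"
  assumes L: "0 < L" and R: "0 < R" and c: "0 < c" "0 < c'" and \<epsilon>: "0 < \<epsilon>"
    and G: "\<And>q. 0 < q \<Longrightarrow> \<exists>t. c * (L * R) ^ q \<le> G q t \<and> G q t \<le> c' * (L * R) ^ q"
  shows "\<exists>Q::nat. \<forall>q\<ge>Q. \<exists>t r. 0 < r \<and> \<bar>r - L\<bar> \<le> \<epsilon> \<and> G q t = (r * R) ^ q"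
proof -
  have ev: "\<forall>\<^sub>F q in sequentially. \<bar>root q d - 1\<bar> < \<epsilon> / L" if "0 < d" for d :: real
    using LIMSEQ_root_const[OF that] \<epsilon> L unfolding tendsto_iff dist_real_def
    by (meson divide_pos_pos)
  have "\<forall>\<^sub>F q in sequentially. \<bar>root q c - 1\<bar> < \<epsilon> / L \<and> \<bar>root q c' - 1\<bar> < \<epsilon> / L \<and> 0 < q"
    using ev[OF c(1)] ev[OF c(2)] eventually_gt_at_top[of 0]
    by eventually_elim auto
  then obtain Q where Q: "\<And>q. Q \<le> q \<Longrightarrow> \<bar>root q c - 1\<bar> < \<epsilon> / L \<and> \<bar>root q c' - 1\<bar> < \<epsilon> / L \<and> 0 < q"
    unfolding eventually_sequentially by blast
  have "\<exists>t r. 0 < r \<and> \<bar>r - L\<bar> \<le> \<epsilon> \<and> G q t = (r * R) ^ q" if q: "Q \<le> q" for q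
  proof -
    have q0: "0 < q" and b: "\<bar>root q c - 1\<bar> < \<epsilon> / L" "\<bar>root q c' - 1\<bar> < \<epsilon> / L"
      using Q[OF q] by auto
    obtain t where t: "c * (L * R) ^ q \<le> G q t" "G q t \<le> c' * (L * R) ^ q" using G[OF q0] by blast
    define d where "d = G q t / (L * R) ^ q"
    have LR: "0 < (L * R) ^ q" using L R by simp
    have d: "c \<le> d" "d \<le> c'" using t LR by (simp_all add: d_def field_simps)
    have d0: "0 < d" using d(1) c(1) by linarith
    have "root q c \<le> root q d" "root q d \<le> root q c'" using d q0 by simp_all
    then have "\<bar>root q d - 1\<bar> < \<epsilon> / L" using b by linarith
    then have "L * \<bar>root q d - 1\<bar> \<le> \<epsilon>" using L by (simp add: field_simps)
    moreover have "\<bar>L * root q d - L\<bar> = L * \<bar>root q d - 1\<bar>"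
      using L by (simp add: abs_mult right_diff_distrib[symmetric, of L _ 1, simplified])
    moreover have "(L * root q d * R) ^ q = G q t"
    proof -
      have "(L * root q d * R) ^ q = (L * R) ^ q * root q d ^ q" by (simp add: power_mult_distrib)
      also have "root q d ^ q = d" using q0 d0 by simp
      also have "(L * R) ^ q * d = G q t"
        unfolding d_def using LR
        by (metis less_irrefl nonzero_mult_div_cancel_left times_divide_eq_right)
      finally show ?thesis .
    qed
    moreover have "0 < L * root q d" using L d0 q0 by simp
    ultimately show ?thesis by metis
  qed
  then show ?thesis by blast
qed

text \<open>With \<open>W = cis t\<close>, the values of \<open>(W - A) (W - B)\<close> at \<open>W\<close> and \<open>- W\<close> add up to \<open>2 (W\<^sup>2 + A B)\<close>; choosing
  \<open>W\<^sup>2\<close> in the direction of \<open>A B\<close> makes one of the two large.\<close>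

lemma ex_large_on_circle:
  "\<exists>t. 1 + cmod (A * B) \<le> cmod (cis t - A) * cmod (cis t - B)"
proof -
  let ?t = "Arg (A * B) / 2"
  have w: "cis ?t * cis ?t = cis (Arg (A * B))" by (simp add: cis_mult)
  have AB: "A * B = of_real (cmod (A * B)) * cis (Arg (A * B))"
    by (metis rcis_cmod_Arg rcis_def)
  have m: "cis (?t + pi) = - cis ?t" by (simp add: cis_mult[symmetric])
  have "(cis ?t - A) * (cis ?t - B) + (cis (?t + pi) - A) * (cis (?t + pi) - B)
      = 2 * (cis ?t * cis ?t + A * B)"
    unfolding m by (simp add: algebra_simps)
  also have "cis ?t * cis ?t + A * B = of_real (1 + cmod (A * B)) * cis (Arg (A * B))"
    unfolding w by (subst AB) (simp add: algebra_simps)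
  finally have "cmod ((cis ?t - A) * (cis ?t - B) + (cis (?t + pi) - A) * (cis (?t + pi) - B))
      = 2 * (1 + cmod (A * B))"
    by (simp only: norm_mult norm_of_real norm_cis) simp
  then have "2 * (1 + cmod (A * B)) \<le> cmod (cis ?t - A) * cmod (cis ?t - B)
      + cmod (cis (?t + pi) - A) * cmod (cis (?t + pi) - B)"
    by (metis norm_mult norm_triangle_ineq)
  moreover have "c \<le> x \<or> c \<le> y" if "2 * c \<le> x + y" for c x y :: real
    using that by linarith
  ultimately have "1 + cmod (A * B) \<le> cmod (cis ?t - A) * cmod (cis ?t - B)
      \<or> 1 + cmod (A * B) \<le> cmod (cis (?t + pi) - A) * cmod (cis (?t + pi) - B)" by blast
  then show ?thesis by blast
qed

lemma cmod_cis_minus_le: "cmod (cis t - A) \<le> 1 + cmod A"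
  using norm_triangle_ineq4[of "cis t" A] by simp

text \<open>Since \<open>\<zeta>\<close> lies on the unit circle, \<open>\<bar>cis t - \<zeta> ^ q\<bar> \<bar>cis t - \<xi> ^ q\<bar>\<close> vanishes for some \<open>t\<close>, and for another
  \<open>t\<close> it is at least \<open>exp (2 q Re g)\<close>. By the intermediate value theorem it takes every value between.\<close>

lemma in_spectrum_below_threshold:
  fixes \<alpha> \<omega> :: real and g lam \<zeta> :: complex
  assumes irr: "\<alpha> \<notin> \<rat>" and g: "0 \<le> Re g"
    and \<zeta>: "cmod \<zeta> = 1" and z: "z = exp (- g) * \<zeta> + exp g / \<zeta>"
    and lam: "cmod lam < exp (Re g)"
  shows "z \<in> spectrum (H g \<alpha> lam \<omega>)"
proof (rule in_spectrum_if_resonant[OF irr g _ z])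
  show "\<zeta> \<noteq> 0" using \<zeta> by auto
  fix \<epsilon> :: real assume \<epsilon>: "0 < \<epsilon>"
  define \<xi> where "\<xi> = exp g * exp g / \<zeta>"
  have \<xi>: "cmod \<xi> = exp (Re g) * exp (Re g)" by (simp add: \<xi>_def norm_mult norm_divide \<zeta>)
  \<comment> \<open>A radius slightly above \<open>cmod lam\<close> is positive even when \<open>lam = 0\<close>.\<close>
  define r where "r = min (cmod lam + \<epsilon>) (exp (Re g))"
  have r: "0 < r" "\<bar>r - cmod lam\<bar> \<le> \<epsilon>" "r \<le> exp (Re g)"
    using \<epsilon> lam by (auto simp: r_def min_def add_nonneg_pos)
  have "\<exists>t. cmod (cis t - \<zeta> ^ q) * cmod (cis t - \<xi> ^ q) = (r * exp (Re g)) ^ q" for q :: nat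
  proof -
    define F where "F t = cmod (cis t - \<zeta> ^ q) * cmod (cis t - \<xi> ^ q)" for t
    have "F (Arg (\<zeta> ^ q)) = 0"
    proof -
      have "cis (Arg (\<zeta> ^ q)) = \<zeta> ^ q"
        using rcis_cmod_Arg[of "\<zeta> ^ q"] by (simp add: rcis_def norm_power \<zeta>)
      then show ?thesis by (simp add: F_def)
    qed
    then have lo: "F (Arg (\<zeta> ^ q)) \<le> (r * exp (Re g)) ^ q" using r(1) by simp
    obtain t where t: "1 + cmod (\<zeta> ^ q * \<xi> ^ q) \<le> F t"
      unfolding F_def using ex_large_on_circle by blast
    have "(r * exp (Re g)) ^ q \<le> (exp (Re g) * exp (Re g)) ^ q"
      by (intro power_mono mult_right_mono) (use r in auto)
    also have "\<dots> \<le> F t" using t by (simp add: norm_mult norm_power \<zeta> \<xi>)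
    finally have hi: "(r * exp (Re g)) ^ q \<le> F t" .
    have "connected (range F)"
      unfolding F_def by (intro connected_continuous_image continuous_intros connected_UNIV)
    then have "(r * exp (Re g)) ^ q \<in> range F"
      using connectedD_interval lo hi by blast
    then show ?thesis unfolding F_def by force
  qed
  then show "\<exists>Q::nat. \<forall>q\<ge>Q. \<exists>t r. 0 < r \<and> \<bar>r - cmod lam\<bar> \<le> \<epsilon> \<and>
      cmod (cis t - \<zeta> ^ q) * cmod (cis t - (exp g * exp g / \<zeta>) ^ q) = (r * exp (Re g)) ^ q"
    using r unfolding \<xi>_def by metis
qed

text \<open>Both \<open>\<zeta>\<close> and \<open>\<xi>\<close> lie outside the open unit disc, so \<open>\<bar>cis t - \<zeta> ^ q\<bar> \<bar>cis t - \<xi> ^ q\<bar>\<close> is at most four times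
  \<open>\<bar>\<zeta> \<xi>\<bar> ^ q = exp (2 q Re g)\<close> everywhere, and at least \<open>\<bar>\<zeta> \<xi>\<bar> ^ q\<close> somewhere.\<close>

lemma in_spectrum_at_threshold:
  fixes \<alpha> \<omega> :: real and g lam \<zeta> :: complex
  assumes irr: "\<alpha> \<notin> \<rat>" and g: "0 \<le> Re g"
    and \<zeta>: "1 \<le> cmod \<zeta>" "cmod \<zeta> \<le> exp (Re g)" and z: "z = exp (- g) * \<zeta> + exp g / \<zeta>"
    and lam: "cmod lam = exp (Re g)"
  shows "z \<in> spectrum (H g \<alpha> lam \<omega>)"
proof (rule in_spectrum_if_resonant[OF irr g _ z])
  show \<zeta>0: "\<zeta> \<noteq> 0" using \<zeta> by auto
  fix \<epsilon> :: real assume \<epsilon>: "0 < \<epsilon>"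
  define \<xi> where "\<xi> = exp g * exp g / \<zeta>"
  have \<zeta>\<xi>: "cmod \<zeta> * cmod \<xi> = cmod lam * exp (Re g)"
    using \<zeta>0 by (simp add: \<xi>_def norm_mult norm_divide lam)
  have "1 * cmod \<zeta> \<le> exp (Re g) * exp (Re g)" using \<zeta> g by (intro mult_mono) auto
  then have \<xi>1: "1 \<le> cmod \<xi>"
    using \<zeta> \<zeta>0 by (simp add: \<xi>_def norm_mult norm_divide field_simps)
  show "\<exists>Q::nat. \<forall>q\<ge>Q. \<exists>t r. 0 < r \<and> \<bar>r - cmod lam\<bar> \<le> \<epsilon> \<and>
      cmod (cis t - \<zeta> ^ q) * cmod (cis t - (exp g * exp g / \<zeta>) ^ q) = (r * exp (Re g)) ^ q"
    unfolding \<xi>_def[symmetric]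
  proof (rule resonance_by_bounds[where c = 1 and c' = 4])
    fix q :: nat
    obtain t where t: "1 + cmod (\<zeta> ^ q * \<xi> ^ q) \<le> cmod (cis t - \<zeta> ^ q) * cmod (cis t - \<xi> ^ q)"
      using ex_large_on_circle by blast
    have "1 \<le> cmod (\<zeta> ^ q)" "1 \<le> cmod (\<xi> ^ q)"
      using \<zeta> \<xi>1 by (simp_all add: norm_power one_le_power)
    then have "cmod (cis t - \<zeta> ^ q) \<le> 2 * cmod (\<zeta> ^ q)" "cmod (cis t - \<xi> ^ q) \<le> 2 * cmod (\<xi> ^ q)"
      using cmod_cis_minus_le[of t "\<zeta> ^ q"] cmod_cis_minus_le[of t "\<xi> ^ q"] by linarith+
    then have "cmod (cis t - \<zeta> ^ q) * cmod (cis t - \<xi> ^ q) \<le> 2 * cmod (\<zeta> ^ q) * (2 * cmod (\<xi> ^ q))"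
      by (intro mult_mono) auto
    also have "\<dots> = 4 * (cmod lam * exp (Re g)) ^ q"
      unfolding \<zeta>\<xi>[symmetric] by (simp add: norm_power power_mult_distrib)
    finally have "cmod (cis t - \<zeta> ^ q) * cmod (cis t - \<xi> ^ q) \<le> 4 * (cmod lam * exp (Re g)) ^ q" .
    moreover have "1 * (cmod lam * exp (Re g)) ^ q \<le> cmod (cis t - \<zeta> ^ q) * cmod (cis t - \<xi> ^ q)"
      using t unfolding \<zeta>\<xi>[symmetric] by (simp add: norm_mult norm_power power_mult_distrib)
    ultimately show "\<exists>t. 1 * (cmod lam * exp (Re g)) ^ q \<le> cmod (cis t - \<zeta> ^ q) * cmod (cis t - \<xi> ^ q)
        \<and> cmod (cis t - \<zeta> ^ q) * cmod (cis t - \<xi> ^ q) \<le> 4 * (cmod lam * exp (Re g)) ^ q" by blast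
  qed (use \<epsilon> lam in auto)
qed

text \<open>The unit circle separates \<open>\<zeta>\<close> from \<open>\<xi>\<close>, so \<open>\<bar>cis t - \<zeta> ^ q\<bar> \<bar>cis t - \<xi> ^ q\<bar>\<close> is comparable to \<open>\<bar>\<xi>\<bar> ^ q\<close> for
  every \<open>t\<close>; the choice \<open>t = 0\<close> will do.\<close>

lemma in_spectrum_above_threshold:
  fixes \<alpha> \<omega> :: real and g lam \<zeta> :: complex
  assumes irr: "\<alpha> \<notin> \<rat>" and g: "0 \<le> Re g"
    and \<zeta>: "\<zeta> \<noteq> 0" "cmod \<zeta> < 1" and z: "z = exp (- g) * \<zeta> + exp g / \<zeta>"
    and lam: "cmod lam = exp (Re g) / cmod \<zeta>"
  shows "z \<in> spectrum (H g \<alpha> lam \<omega>)"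
proof (rule in_spectrum_if_resonant[OF irr g \<zeta>(1) z])
  fix \<epsilon> :: real assume \<epsilon>: "0 < \<epsilon>"
  define \<xi> where "\<xi> = exp g * exp g / \<zeta>"
  have \<xi>: "cmod \<xi> = cmod lam * exp (Re g)" by (simp add: \<xi>_def norm_mult norm_divide lam)
  have l1: "1 < cmod lam"
  proof -
    have "1 \<le> exp (Re g)" using g by simp
    then have "cmod \<zeta> < exp (Re g)" using \<zeta>(2) by linarith
    then show ?thesis using \<zeta> by (simp add: lam field_simps)
  qed
  have \<xi>1: "1 < cmod \<xi>" unfolding \<xi> using l1 g by (simp add: less_1_mult' mult.commute)
  show "\<exists>Q::nat. \<forall>q\<ge>Q. \<exists>t r. 0 < r \<and> \<bar>r - cmod lam\<bar> \<le> \<epsilon> \<and>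
      cmod (cis t - \<zeta> ^ q) * cmod (cis t - (exp g * exp g / \<zeta>) ^ q) = (r * exp (Re g)) ^ q"
    unfolding \<xi>_def[symmetric]
  proof (rule resonance_by_bounds[where c = "(1 - cmod \<zeta>) * (1 - 1 / cmod \<xi>)" and c' = 4])
    fix q :: nat assume q: "0 < q"
    have p\<zeta>: "cmod \<zeta> ^ q \<le> cmod \<zeta>" using power_decreasing[of 1 q "cmod \<zeta>"] \<zeta> q by simp
    have p\<xi>: "cmod \<xi> \<le> cmod \<xi> ^ q" using power_increasing[of 1 q "cmod \<xi>"] \<xi>1 q by simp
    have l\<zeta>: "1 - cmod \<zeta> \<le> cmod (cis 0 - \<zeta> ^ q)"
      using norm_triangle_ineq2[of "cis 0" "\<zeta> ^ q"] p\<zeta> by (simp add: norm_power)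
    have "0 < cmod \<xi>" using \<xi>1 by linarith
    then have "1 \<le> cmod \<xi> ^ q / cmod \<xi>" using p\<xi> by (simp only: le_divide_eq_1_pos)
    moreover have "cmod \<xi> ^ q - 1 \<le> cmod (cis 0 - \<xi> ^ q)"
      using norm_triangle_ineq3[of "cis 0" "\<xi> ^ q"] by (simp add: norm_power)
    ultimately have l\<xi>: "(1 - 1 / cmod \<xi>) * cmod \<xi> ^ q \<le> cmod (cis 0 - \<xi> ^ q)"
      by (simp add: left_diff_distrib)
    have u\<zeta>: "cmod (cis 0 - \<zeta> ^ q) \<le> 2"
      using cmod_cis_minus_le[of 0 "\<zeta> ^ q"] p\<zeta> \<zeta> by (simp add: norm_power)
    have u\<xi>: "cmod (cis 0 - \<xi> ^ q) \<le> 2 * cmod \<xi> ^ q"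
      using cmod_cis_minus_le[of 0 "\<xi> ^ q"] p\<xi> \<xi>1 by (simp add: norm_power)
    have "(1 - cmod \<zeta>) * ((1 - 1 / cmod \<xi>) * cmod \<xi> ^ q) \<le> cmod (cis 0 - \<zeta> ^ q) * cmod (cis 0 - \<xi> ^ q)"
      by (intro mult_mono l\<zeta> l\<xi>) (use \<xi>1 in \<open>auto simp: divide_le_eq_1\<close>)
    moreover have "cmod (cis 0 - \<zeta> ^ q) * cmod (cis 0 - \<xi> ^ q) \<le> 2 * (2 * cmod \<xi> ^ q)"
      by (intro mult_mono u\<zeta> u\<xi>) auto
    ultimately show "\<exists>t. (1 - cmod \<zeta>) * (1 - 1 / cmod \<xi>) * (cmod lam * exp (Re g)) ^ q
          \<le> cmod (cis t - \<zeta> ^ q) * cmod (cis t - \<xi> ^ q)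
        \<and> cmod (cis t - \<zeta> ^ q) * cmod (cis t - \<xi> ^ q) \<le> 4 * (cmod lam * exp (Re g)) ^ q"
      unfolding \<xi>[symmetric] by (intro exI[of _ 0]) (simp add: mult.assoc)
  qed (use \<epsilon> l1 \<zeta> \<xi>1 in \<open>auto simp: divide_less_eq_1\<close>)
qed

section \<open>The spectrum\<close>

text \<open>The two solutions \<open>x\<close> and \<open>y\<close> of the quadratic equation for \<open>\<zeta>\<close> have product \<open>exp (2 g)\<close>, so one of them
  has modulus at most \<open>exp (Re g)\<close>.\<close>

lemma small_root_exists:
  fixes g z :: complex
  obtains \<zeta> where "\<zeta> \<noteq> 0" "cmod \<zeta> \<le> exp (Re g)" "z = exp (- g) * \<zeta> + exp g / \<zeta>"
proof -
  define s where "s = csqrt (z\<^sup>2 - 4)"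
  define x y where "x = (z + s) / 2 * exp g" and "y = (z - s) / 2 * exp g"
  have e: "exp (- g) * exp g = 1" by (simp flip: exp_add)
  have s2: "s\<^sup>2 = z\<^sup>2 - 4" by (simp add: s_def)
  have xy: "x * y = exp g * exp g"
  proof -
    have "x * y = (z\<^sup>2 - s\<^sup>2) / 4 * (exp g * exp g)"
      by (simp add: x_def y_def power2_eq_square algebra_simps)
    then show ?thesis by (simp add: s2)
  qed
  have sum: "exp (- g) * x + exp (- g) * y = z"
    using e by (simp add: x_def y_def field_simps exp_minus)
  have nz: "x \<noteq> 0" "y \<noteq> 0" using xy by auto
  have cm: "cmod x * cmod y = exp (Re g) * exp (Re g)"
    using arg_cong[OF xy, of cmod] by (simp add: norm_mult)
  have xe: "exp g / x = exp (- g) * y" and ye: "exp g / y = exp (- g) * x"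
    using xy nz e by (simp_all add: field_simps exp_minus)
  show ?thesis
  proof (cases "cmod x \<le> exp (Re g)")
    case True
    show ?thesis by (rule that[OF nz(1) True]) (simp add: xe sum)
  next
    case False
    have "cmod y \<le> exp (Re g)"
    proof (rule ccontr)
      assume "\<not> cmod y \<le> exp (Re g)"
      with False have "exp (Re g) * exp (Re g) < cmod x * cmod y"
        by (intro mult_strict_mono) auto
      then show False using cm by simp
    qed
    then show ?thesis by (rule that[OF nz(2)]) (simp add: ye sum add.commute)
  qed
qed

lemma ex_cis_unit_interval: "\<exists>\<theta>\<in>{0..1}. z = of_real (cmod z) * cis (2 * pi * \<theta>)"
proof -
  have "z = of_real (cmod z) * cis (Arg2pi z)"
    using Arg2pi_eq[of z] by (simp add: cis_conv_exp)
  then have "z = of_real (cmod z) * cis (2 * pi * (Arg2pi z / (2 * pi)))" by simp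
  moreover have "Arg2pi z / (2 * pi) \<in> {0..1}"
    using Arg2pi_ge_0[of z] Arg2pi_lt_2pi[of z] by (auto simp: divide_le_eq_1)
  ultimately show ?thesis by blast
qed

theorem corollary1p4:
  fixes \<alpha> \<omega> :: real and lam g :: complex
  assumes "\<alpha> \<notin> \<rat>" and "0 \<le> Re g"
  shows "spectrum (H g \<alpha> lam \<omega>) =
    (if cmod lam < exp (Re g) then
       {exp (- g) * cis (2 * pi * \<theta>) + exp g * cis (- 2 * pi * \<theta>) |\<theta>::real. \<theta> \<in> {0..1}}
     else if cmod lam = exp (Re g) then
       {of_real \<eta> * exp (- g) * cis (2 * pi * \<theta>) + of_real (1 / \<eta>) * exp g * cis (- 2 * pi * \<theta>)
         |(\<eta>::real) (\<theta>::real). \<eta> \<in> {1..exp (Re g)} \<and> \<theta> \<in> {0..1}}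
     else
       {of_real (exp (Re g) / cmod lam) * exp (- g) * cis (2 * pi * \<theta>)
         + of_real (exp (- Re g) * cmod lam) * exp g * cis (- 2 * pi * \<theta>) |\<theta>::real. \<theta> \<in> {0..1}})"
proof -
  let ?\<sigma> = "spectrum (H g \<alpha> lam \<omega>)"
  let ?z = "\<lambda>\<eta> \<theta>. of_real \<eta> * exp (- g) * cis (2 * pi * \<theta>)
    + of_real (1 / \<eta>) * exp g * cis (- 2 * pi * \<theta>)"
  have circle: "?z \<eta> \<theta> = exp (- g) * \<zeta> + exp g / \<zeta>"
    if "\<zeta> = of_real \<eta> * cis (2 * pi * \<theta>)" for \<eta> \<theta> :: real and \<zeta>
    unfolding that by (simp add: cis_inverse divide_inverse mult_ac)
  have split: "\<exists>\<zeta>. \<zeta> \<noteq> 0 \<and> cmod \<zeta> \<le> exp (Re g) \<and> z = exp (- g) * \<zeta> + exp g / \<zeta>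
      \<and> (\<exists>\<theta>\<in>{0..1}. z = ?z (cmod \<zeta>) \<theta>)" for z
    using small_root_exists[of g z] circle ex_cis_unit_interval by metis
  have cm: "cmod (of_real \<eta> * cis (2 * pi * \<theta>)) = \<eta>" if "0 \<le> \<eta>" for \<eta> \<theta> :: real
    using that by (simp add: norm_mult)
  consider "cmod lam < exp (Re g)" | "cmod lam = exp (Re g)" | "exp (Re g) < cmod lam" by linarith
  then show ?thesis
  proof cases
    case 1
    have "?\<sigma> = {?z 1 \<theta> |\<theta>. \<theta> \<in> {0..1}}"
    proof (intro subset_antisym subsetI)
      fix z assume z: "z \<in> ?\<sigma>"
      obtain \<zeta> \<theta> where \<zeta>: "\<zeta> \<noteq> 0" "cmod \<zeta> \<le> exp (Re g)" "z = exp (- g) * \<zeta> + exp g / \<zeta>"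
        "\<theta> \<in> {0..1}" "z = ?z (cmod \<zeta>) \<theta>" using split by blast
      have "exp (Re g) * 1 \<le> exp (Re g) * max 1 (1 / cmod \<zeta>)" by (intro mult_left_mono) auto
      then have "cmod lam < exp (Re g) * max 1 (1 / cmod \<zeta>)" using 1 by linarith
      then have "cmod \<zeta> = 1"
        using not_in_spectrum[OF assms \<zeta>(1-3), of lam \<omega>] z by blast
      then show "z \<in> {?z 1 \<theta> |\<theta>. \<theta> \<in> {0..1}}" using \<zeta>(4,5) by auto
    next
      fix z assume "z \<in> {?z 1 \<theta> |\<theta>. \<theta> \<in> {0..1}}"
      then obtain \<theta> where "z = ?z 1 \<theta>" by blast
      then show "z \<in> ?\<sigma>"
        using in_spectrum_below_threshold[OF assms cm[of 1 \<theta>] circle[OF refl] 1] by simp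
    qed
    then show ?thesis using 1 by simp
  next
    case 2
    have "?\<sigma> = {?z \<eta> \<theta> |\<eta> \<theta>. \<eta> \<in> {1..exp (Re g)} \<and> \<theta> \<in> {0..1}}"
    proof (intro subset_antisym subsetI)
      fix z assume z: "z \<in> ?\<sigma>"
      obtain \<zeta> \<theta> where \<zeta>: "\<zeta> \<noteq> 0" "cmod \<zeta> \<le> exp (Re g)" "z = exp (- g) * \<zeta> + exp g / \<zeta>"
        "\<theta> \<in> {0..1}" "z = ?z (cmod \<zeta>) \<theta>" using split by blast
      have "1 \<le> cmod \<zeta>"
      proof (rule ccontr)
        assume "\<not> 1 \<le> cmod \<zeta>"
        then have "1 < max 1 (1 / cmod \<zeta>)" "cmod \<zeta> \<noteq> 1" using \<zeta>(1) by (auto simp: less_divide_eq_1_pos)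
        then have "exp (Re g) * 1 < exp (Re g) * max 1 (1 / cmod \<zeta>)"
          by (intro mult_strict_left_mono) auto
        then have "cmod lam < exp (Re g) * max 1 (1 / cmod \<zeta>)" using 2 by linarith
        with \<open>cmod \<zeta> \<noteq> 1\<close> show False
          using not_in_spectrum[OF assms \<zeta>(1-3), of lam \<omega>] z by blast
      qed
      then show "z \<in> {?z \<eta> \<theta> |\<eta> \<theta>. \<eta> \<in> {1..exp (Re g)} \<and> \<theta> \<in> {0..1}}"
        using \<zeta>(2,4,5) by fastforce
    next
      fix z assume "z \<in> {?z \<eta> \<theta> |\<eta> \<theta>. \<eta> \<in> {1..exp (Re g)} \<and> \<theta> \<in> {0..1}}"
      then obtain \<eta> \<theta> where "z = ?z \<eta> \<theta>" "1 \<le> \<eta>" "\<eta> \<le> exp (Re g)" by auto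
      then show "z \<in> ?\<sigma>"
        using in_spectrum_at_threshold[OF assms _ _ circle[OF refl] 2, of \<eta> \<theta>] cm[of \<eta> \<theta>] by simp
    qed
    then show ?thesis using 2 by simp
  next
    case 3
    define \<eta> where "\<eta> = exp (Re g) / cmod lam"
    have lam: "0 < cmod lam" using 3 exp_gt_zero[of "Re g"] by linarith
    have \<eta>: "0 < \<eta>" "\<eta> < 1" "1 / \<eta> = exp (- Re g) * cmod lam" "exp (Re g) / \<eta> = cmod lam"
      using 3 lam by (auto simp: \<eta>_def exp_minus field_simps)
    have "?\<sigma> = {?z \<eta> \<theta> |\<theta>. \<theta> \<in> {0..1}}"
    proof (intro subset_antisym subsetI)
      fix z assume z: "z \<in> ?\<sigma>"
      obtain \<zeta> \<theta> where \<zeta>: "\<zeta> \<noteq> 0" "cmod \<zeta> \<le> exp (Re g)" "z = exp (- g) * \<zeta> + exp g / \<zeta>"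
        "\<theta> \<in> {0..1}" "z = ?z (cmod \<zeta>) \<theta>" using split by blast
      have n: "\<not> (cmod \<zeta> \<noteq> 1 \<and> cmod lam < exp (Re g) * max 1 (1 / cmod \<zeta>)
          \<or> cmod lam > exp (Re g) * max 1 (1 / cmod \<zeta>))"
        using not_in_spectrum[OF assms \<zeta>(1-3), of lam \<omega>] z by blast
      have "cmod \<zeta> < 1"
      proof (rule ccontr)
        assume "\<not> cmod \<zeta> < 1"
        then have "max 1 (1 / cmod \<zeta>) = 1" by (simp add: divide_le_eq_1)
        then show False using n 3 by simp
      qed
      then have "max 1 (1 / cmod \<zeta>) = 1 / cmod \<zeta>" "cmod \<zeta> \<noteq> 1"
        using \<zeta>(1) by (auto simp: max_def divide_le_eq_1)
      then have "cmod lam = exp (Re g) / cmod \<zeta>" using n by simp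
      then have "cmod \<zeta> = \<eta>" using \<zeta>(1) lam by (simp add: \<eta>_def)
      then show "z \<in> {?z \<eta> \<theta> |\<theta>. \<theta> \<in> {0..1}}" using \<zeta>(4,5) by auto
    next
      fix z assume "z \<in> {?z \<eta> \<theta> |\<theta>. \<theta> \<in> {0..1}}"
      then obtain \<theta> where "z = ?z \<eta> \<theta>" by blast
      then show "z \<in> ?\<sigma>"
        using in_spectrum_above_threshold[OF assms _ _ circle[OF refl], of \<eta> \<theta> lam \<omega>] cm[of \<eta> \<theta>] \<eta>
        by simp
    qed
    then show ?thesis using 3 unfolding \<eta>(3)[symmetric] \<eta>_def[symmetric] by simp
  qed
qed

end
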